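(* Let $\beta>0$. Then, for a scalar type spectral operator $A$ in a complex Banach space $(X,\|\cdot\|)$, $$\mathcal{E}^{\{\beta\}}(A)=\bigcup_{t>0}D\big(e^{t|A|^{1/\beta}}\big),\qquad \mathcal{E}^{(\beta)}(A)=\bigcap_{t>0}D\big(e^{t|A|^{1/\beta}}\big).$$
   Context: $\mathbb{Z}_+=\{0,1,2,\dots\}$, $\mathbb{N}=\{1,2,3,\dots\}$; $D(\cdot)$ denotes the domain of an operator. Scalar type spectral operators and operational calculus. Let $X$ be a complex Banach space. A spectral measure $E$ on $X$ assigns to each Borel set $\delta\subseteq\mathbb{C}$ a bounded projection $E(\delta)$ on $X$, is strongly countably additive, and satisfies $E(\mathbb{C})=I$ and $E(\delta\cap\sigma)=E(\delta)E(\sigma)$. Such $E$ is uniformly bounded, and for a bounded Borel function $G:\mathbb{C}\to\mathbb{C}$ the integral $\int_{\mathbb{C}} G\,dE$ is the bounded operator obtained as the operator-norm limit of the integrals of simple Borel functions converging uniformly to $G$. For an arbitrary Borel measurable $G:\mathbb{C}\to\mathbb{C}$ put $G_n:=G\,\chi_{\{\lambda\,:\,|G(\lambda)|\le n\}}$, $n\in\mathbb{N}$, and define the operator $\int_{\mathbb{C}} G\,dE$ by $$\Big(\int_{\mathbb{C}} G\,dE\Big)f:=\lim_{n\to\infty}\Big(\int_{\mathbb{C}} G_n\,dE\Big)f$$ with domain the set of all $f\in X$ for which this limit exists. A (possibly unbounded, densely defined, closed) linear operator $A$ in $X$ is a scalar type spectral operator if there is a spectral measure $E_A$ with $A=\int_{\mathbb{C}}\lambda\,dE_A(\lambda)$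 (equality including domains). Then $E_A$ is unique, is called the spectral measure (resolution of the identity) of $A$, and is supported on the spectrum $\sigma(A)$. For Borel measurable $G:\mathbb{C}\to\mathbb{C}$ (or $G:\sigma(A)\to\mathbb{C}$) one writes $G(A):=\int_{\mathbb{C}}G\,dE_A=\int_{\sigma(A)}G\,dE_A$. In particular $e^{t|A|^{1/\beta}}$ denotes $G(A)$ with $G(\lambda)=e^{t|\lambda|^{1/\beta}}$. Gevrey classes. $C^\infty(A):=\bigcap_{n=0}^\infty D(A^n)$, and for $\beta\ge 0$ $$\mathcal{E}^{\{\beta\}}(A):=\{f\in C^\infty(A): \exists\alpha>0\ \exists c>0:\ \|A^nf\|\le c\,\alpha^n [n!]^\beta,\ n\in\mathbb{Z}_+\},$$ $$\mathcal{E}^{(\beta)}(A):=\{f\in C^\infty(A): \forall\alpha>0\ \exists c>0:\ \|A^nf\|\le c\,\alpha^n [n!]^\beta,\ n\in\mathbb{Z}_+\}.$$ *)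

theory Defs
  imports "HOL-Analysis.Analysis"
begin

section \<open>Complex Banach spaces\<close>

class complex_banach = banach +
  fixes scaleC :: "complex \<Rightarrow> 'a \<Rightarrow> 'a"  (infixr "*\<^sub>C" 75)
  assumes scaleC_add_right: "a *\<^sub>C (x + y) = a *\<^sub>C x + a *\<^sub>C y"
    and scaleC_add_left: "(a + b) *\<^sub>C x = a *\<^sub>C x + b *\<^sub>C x"
    and scaleC_scaleC: "a *\<^sub>C b *\<^sub>C x = (a * b) *\<^sub>C x"
    and scaleR_scaleC: "r *\<^sub>R x = complex_of_real r *\<^sub>C x"
    and norm_scaleC: "norm (a *\<^sub>C x) = cmod a * norm x"

instantiation complex :: complex_banach
begin

definition scaleC_complex :: "complex \<Rightarrow> complex \<Rightarrow> complex" where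
  "scaleC_complex a x = a * x"

instance
  by standard (simp_all add: scaleC_complex_def algebra_simps norm_mult scaleR_conv_of_real)

end

definition bounded_clinear :: "('a::complex_banach \<Rightarrow> 'a) \<Rightarrow> bool" where
  "bounded_clinear T \<longleftrightarrow> bounded_linear T \<and> (\<forall>c x. T (c *\<^sub>C x) = c *\<^sub>C T x)"


section \<open>Unbounded operators\<close>

text \<open>
  An operator in \<open>X\<close> is a partial function, its domain \<open>D(A)\<close> being \<open>dom A\<close>; hence
  \<open>A = B\<close> includes equality of the domains, and \<open>\<circ>\<^sub>m\<close> is the composition of operators on its
  natural domain.
\<close>

type_synonym 'a operator = "'a \<rightharpoonup> 'a"

definition linear_operator :: "'a::complex_banach operator \<Rightarrow> bool" where
  "linear_operator A \<longleftrightarrow>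
     A 0 = Some 0 \<and>
     (\<forall>x y u v. A x = Some u \<longrightarrow> A y = Some v \<longrightarrow> A (x + y) = Some (u + v)) \<and>
     (\<forall>c x u. A x = Some u \<longrightarrow> A (c *\<^sub>C x) = Some (c *\<^sub>C u))"

definition densely_defined :: "'a::complex_banach operator \<Rightarrow> bool" where
  "densely_defined A \<longleftrightarrow> closure (dom A) = UNIV"

definition closed_operator :: "'a::complex_banach operator \<Rightarrow> bool" where
  "closed_operator A \<longleftrightarrow> closed {(x, y). A x = Some y}"

primrec operator_power :: "'a operator \<Rightarrow> nat \<Rightarrow> 'a operator" where
  "operator_power A 0 = Some"
| "operator_power A (Suc n) = A \<circ>\<^sub>m operator_power A n"


section \<open>Spectral measures and their integrals\<close>

text \<open>
  Only the values \<open>E \<delta>\<close> at Borel sets \<open>\<delta>\<close> are meaningful; those at other sets are unconstrained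
  and never used.
\<close>

definition spectral_measure :: "(complex set \<Rightarrow> 'a::complex_banach \<Rightarrow> 'a) \<Rightarrow> bool" where
  "spectral_measure E \<longleftrightarrow>
     (\<forall>\<delta>\<in>sets borel. bounded_clinear (E \<delta>) \<and> E \<delta> \<circ> E \<delta> = E \<delta>) \<and>
     (\<forall>\<delta>::nat \<Rightarrow> complex set. range \<delta> \<subseteq> sets borel \<longrightarrow> disjoint_family \<delta> \<longrightarrow>
        (\<forall>f. (\<lambda>n. E (\<delta> n) f) sums E (\<Union>n. \<delta> n) f)) \<and>
     E UNIV = id \<and>
     (\<forall>\<delta>\<in>sets borel. \<forall>\<sigma>\<in>sets borel. E (\<delta> \<inter> \<sigma>) = E \<delta> \<circ> E \<sigma>)"

definition simple_spectral_integral ::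
  "(complex set \<Rightarrow> 'a::complex_banach \<Rightarrow> 'a) \<Rightarrow> (complex \<Rightarrow> complex) \<Rightarrow> 'a \<Rightarrow> 'a" where
  "simple_spectral_integral E s f = (\<Sum>c\<in>range s. c *\<^sub>C E (s -` {c}) f)"

text \<open>
  For a bounded Borel function \<open>G\<close>: the limit in operator norm of the integrals of simple Borel
  functions converging uniformly to \<open>G\<close>, whichever such sequence is taken.
\<close>

definition bounded_spectral_integral ::
  "(complex set \<Rightarrow> 'a::complex_banach \<Rightarrow> 'a) \<Rightarrow> (complex \<Rightarrow> complex) \<Rightarrow> 'a \<Rightarrow> 'a" where
  "bounded_spectral_integral E G =
     (THE T. bounded_clinear T \<and>
        (\<forall>s. (\<forall>n. simple_function borel (s n)) \<longrightarrow> uniform_limit UNIV s G sequentially \<longrightarrow>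
           (\<lambda>n. onorm (\<lambda>f. simple_spectral_integral E (s n) f - T f)) \<longlonglongrightarrow> 0))"

definition spectral_truncation :: "(complex \<Rightarrow> complex) \<Rightarrow> nat \<Rightarrow> complex \<Rightarrow> complex" where
  "spectral_truncation G n z = (if cmod (G z) \<le> real n then G z else 0)"

definition spectral_integral ::
  "(complex set \<Rightarrow> 'a::complex_banach \<Rightarrow> 'a) \<Rightarrow> (complex \<Rightarrow> complex) \<Rightarrow> 'a operator" where
  "spectral_integral E G f =
     (if convergent (\<lambda>n. bounded_spectral_integral E (spectral_truncation G n) f)
      then Some (lim (\<lambda>n. bounded_spectral_integral E (spectral_truncation G n) f))
      else None)"


section \<open>Scalar type spectral operators and their calculus\<close>

definition resolution_of_identity ::
  "'a::complex_banach operator \<Rightarrow> (complex set \<Rightarrow> 'a \<Rightarrow> 'a) \<Rightarrow> bool" where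
  "resolution_of_identity A E \<longleftrightarrow> spectral_measure E \<and> A = spectral_integral E (\<lambda>z. z)"

definition scalar_type_spectral :: "'a::complex_banach operator \<Rightarrow> bool" where
  "scalar_type_spectral A \<longleftrightarrow>
     linear_operator A \<and> densely_defined A \<and> closed_operator A \<and>
     (\<exists>E. resolution_of_identity A E)"

text \<open>
  The spectral measure of \<open>A\<close> is unique on the Borel sets, so the choice made here does not affect
  the integral of any Borel function.
\<close>

definition spectral_measure_of ::
  "'a::complex_banach operator \<Rightarrow> complex set \<Rightarrow> 'a \<Rightarrow> 'a" where
  "spectral_measure_of A = (SOME E. resolution_of_identity A E)"

definition operator_function ::
  "(complex \<Rightarrow> complex) \<Rightarrow> 'a::complex_banach operator \<Rightarrow> 'a operator" where
  "operator_function G A = spectral_integral (spectral_measure_of A) G"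


section \<open>Gevrey classes\<close>

definition C_infinity :: "'a operator \<Rightarrow> 'a set" where
  "C_infinity A = (\<Inter>n. dom (operator_power A n))"

definition gevrey_roumieu :: "real \<Rightarrow> 'a::complex_banach operator \<Rightarrow> 'a set" where
  "gevrey_roumieu \<beta> A = {f \<in> C_infinity A. \<exists>\<alpha>>0. \<exists>c>0. \<forall>n.
     norm (the (operator_power A n f)) \<le> c * \<alpha> ^ n * fact n powr \<beta>}"

definition gevrey_beurling :: "real \<Rightarrow> 'a::complex_banach operator \<Rightarrow> 'a set" where
  "gevrey_beurling \<beta> A = {f \<in> C_infinity A. \<forall>\<alpha>>0. \<exists>c>0. \<forall>n.
     norm (the (operator_power A n f)) \<le> c * \<alpha> ^ n * fact n powr \<beta>}"

end

theory Submission
  imports Defs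
begin

text \<open>
  Everything rests on one description of the calculus: \<open>f\<close> lies in the domain of the integral of
  \<open>G\<close>, with value \<open>g\<close>, iff for Borel sets \<open>\<sigma>\<close> increasing to the plane on which \<open>G\<close> is bounded, the
  integral of \<open>G\<close> over \<open>\<sigma>\<close> applied to \<open>f\<close> tends to \<open>g\<close>; it is then equal to \<open>E(\<sigma>) g\<close>. Hence
  \<open>(G F)(A) f = G(A) (F(A) f)\<close> as soon as \<open>F(A) f\<close> exists, which identifies \<open>A ^ n\<close> with the integral
  of \<open>z ^ n\<close> without passing to the dual space.

  If \<open>exp (t |A| ^ (1 / \<beta>)) f\<close> exists, then \<open>|z| ^ n \<le> \<alpha> ^ n n! ^ \<beta> exp (t |z| ^ (1 / \<beta>))\<close> with
  \<open>\<alpha> = (t / \<beta>) ^ (- \<beta>)\<close> gives the Gevrey bound. Conversely, on the shell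
  \<open>k \<le> |z| ^ (1 / \<beta>) < k + 1\<close> the exponential is compared with \<open>z ^ n\<close> for
  \<open>n = \<lfloor>k \<theta>\<rfloor>\<close>, \<open>\<theta> = \<alpha> ^ (- 1 / \<beta>) / e\<close>; the contributions of the shells then decay like
  \<open>exp (k (t - \<beta> \<theta>))\<close> and are summable for \<open>t < \<beta> \<theta>\<close>. As \<open>\<alpha>\<close> and \<open>t\<close> determine each other up to
  constants, with \<open>\<alpha> \<rightarrow> 0\<close> corresponding to \<open>t \<rightarrow> \<infinity>\<close>, both equalities follow.
\<close>

section \<open>Uniform boundedness and linear combinations\<close>

text \<open>Baire category: the closed sets \<open>C n\<close> cover the space, so one of them
  contains a ball around some \<open>x0\<close>. A vector of length \<open>r\<close> is the
  difference of two points of that ball, whence \<open>2 * real n / r\<close>.\<close>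

lemma uniform_boundedness:
  fixes T :: "'i \<Rightarrow> 'a::banach \<Rightarrow> 'b::real_normed_vector"
  assumes lin: "\<And>i. i \<in> I \<Longrightarrow> bounded_linear (T i)"
    and bdd: "\<And>x. \<exists>B. \<forall>i\<in>I. norm (T i x) \<le> B"
  shows "\<exists>K\<ge>0. \<forall>i\<in>I. \<forall>x. norm (T i x) \<le> K * norm x"
proof -
  define C where "C n = (\<Inter>i\<in>I. {x. norm (T i x) \<le> real n})" for n :: nat
  have closed: "closed (C n)" for n
    unfolding C_def
    by (intro closed_INT ballI closed_Collect_le continuous_intros
        bounded_linear.continuous_on[OF lin])
  have cover: "(\<Union>n. C n) = UNIV"
  proof -
    have "\<exists>n. x \<in> C n" for x
    proof -
      obtain B where "\<forall>i\<in>I. norm (T i x) \<le> B" using bdd by blast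
      moreover obtain n where "B \<le> real n" using real_arch_simple by blast
      ultimately show ?thesis unfolding C_def by (force intro: order_trans)
    qed
    then show ?thesis by blast
  qed
  have "\<exists>n. interior (C n) \<noteq> {}"
  proof (rule ccontr)
    assume "\<not> ?thesis"
    then have "interior (\<Union>(range C)) = {}"
      using Met_TC.metric_Baire_category_alt[of "range C"] closed
      by (auto simp: mtopology_is_euclidean complete_UNIV)
    then show False using cover by simp
  qed
  then obtain n x0 r where r: "r > 0" "cball x0 r \<subseteq> C n"
    by (auto simp: mem_interior_cball)
  have "norm (T i x) \<le> 2 * real n / r * norm x" if i: "i \<in> I" for i x
  proof (cases "x = 0")
    case True
    interpret bounded_linear "T i" using lin i .
    show ?thesis using True by (simp add: zero)
  next
    case False
    interpret bounded_linear "T i" using lin i .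
    define y where "y = (r / norm x) *\<^sub>R x"
    have "norm (T i (x0 + y)) \<le> real n" "norm (T i x0) \<le> real n"
      using r i False by (auto simp: C_def y_def subset_iff dist_norm)
    then have "norm (T i (x0 + y) - T i x0) \<le> 2 * real n"
      by (intro norm_triangle_le_diff) simp
    then have "norm (T i y) \<le> 2 * real n"
      by (simp add: add)
    moreover have "norm (T i y) = r / norm x * norm (T i x)"
      using r by (simp add: y_def scaleR)
    ultimately show ?thesis using r False by (simp add: field_simps)
  qed
  then show ?thesis using r(1) by (intro exI[of _ "2 * real n / r"]) auto
qed

text \<open>The norm is convex in each coefficient separately, so over the cube it is largest at a
  vertex, and the vertices are the subset sums. The free offset \<open>a\<close> lets the induction
  absorb \<open>x j\<close> when the coefficient of \<open>j\<close> is moved to 1.\<close>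

lemma norm_affine_combination_le:
  fixes x :: "'i \<Rightarrow> 'b::real_normed_vector"
  assumes "finite I" "\<And>J. J \<subseteq> I \<Longrightarrow> norm (a + sum x J) \<le> B"
    and "\<And>i. i \<in> I \<Longrightarrow> 0 \<le> c i \<and> c i \<le> 1"
  shows "norm (a + (\<Sum>i\<in>I. c i *\<^sub>R x i)) \<le> B"
  using assms
proof (induction I arbitrary: a rule: finite_induct)
  case empty
  then show ?case by fastforce
next
  case (insert j I)
  let ?S = "\<Sum>i\<in>I. c i *\<^sub>R x i"
  have 1: "norm (a + ?S) \<le> B"
    using insert.prems insert.hyps by (intro insert.IH) auto
  have 2: "norm ((a + x j) + ?S) \<le> B"
  proof (intro insert.IH)
    fix J assume J: "J \<subseteq> I"
    then have "finite J" "j \<notin> J" using insert.hyps finite_subset by auto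
    then show "norm (a + x j + sum x J) \<le> B"
      using insert.prems(1)[of "insert j J"] J by (auto simp: add.assoc)
  qed (use insert.prems in auto)
  have c: "0 \<le> c j" "c j \<le> 1" using insert.prems(2) by auto
  have "a + (\<Sum>i\<in>insert j I. c i *\<^sub>R x i) = (1 - c j) *\<^sub>R (a + ?S) + c j *\<^sub>R ((a + x j) + ?S)"
    using insert.hyps by (simp add: algebra_simps)
  also have "norm \<dots> \<le> (1 - c j) * norm (a + ?S) + c j * norm ((a + x j) + ?S)"
    using c by (intro norm_triangle_le) simp
  also have "\<dots> \<le> B"
    using 1 2 c by (intro convex_bound_le) auto
  finally show ?case .
qed

section \<open>Complex linear combinations\<close>

lemma bounded_linear_scaleC: "bounded_linear (\<lambda>x::'a::complex_banach. c *\<^sub>C x)"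
  by (rule bounded_linear_intro[of _ "cmod c"])
    (simp_all add: scaleC_add_right scaleR_scaleC scaleC_scaleC norm_scaleC mult.commute)

lemmas scaleC_right_zero [simp] = linear_0[OF bounded_linear.linear[OF bounded_linear_scaleC]]
  and scaleC_right_sum = linear_sum[OF bounded_linear.linear[OF bounded_linear_scaleC]]

lemma scaleC_zero_left [simp]: "0 *\<^sub>C (x::'a::complex_banach) = 0"
  using norm_scaleC[of 0 x] by simp

lemma scaleC_one [simp]: "1 *\<^sub>C (x::'a::complex_banach) = x"
  using scaleR_scaleC[of 1 x] by simp

lemma scaleC_diff_left: "(a - b) *\<^sub>C (x::'a::complex_banach) = a *\<^sub>C x - b *\<^sub>C x"
  using scaleC_add_left[of "a - b" b x] by (simp add: algebra_simps)

text \<open>This takes the place of a total variation estimate through functionals: control of a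
  vector measure on sets gives control of its integrals. The 4 counts the positive and negative
  parts of the real and imaginary parts of the coefficients.\<close>

lemma norm_complex_combination_le:
  fixes x :: "'i \<Rightarrow> 'a::complex_banach"
  assumes fin: "finite I" and sub: "\<And>J. J \<subseteq> I \<Longrightarrow> norm (sum x J) \<le> B"
    and c: "\<And>i. i \<in> I \<Longrightarrow> cmod (c i) \<le> b" and b: "b \<ge> 0"
  shows "norm (\<Sum>i\<in>I. c i *\<^sub>C x i) \<le> 4 * B * b"
proof (cases "b = 0")
  case True
  have "c i *\<^sub>C x i = 0" if "i \<in> I" for i
  proof -
    have "norm (c i *\<^sub>C x i) = 0" using c[OF that] True by (simp add: norm_scaleC)
    then show ?thesis by simp
  qed
  then show ?thesis using True by simp
next
  case False
  then have b: "b > 0" using b by simp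
  have pos: "norm (\<Sum>i\<in>I. d i *\<^sub>R x i) \<le> B * b" if "\<And>i. i \<in> I \<Longrightarrow> 0 \<le> d i \<and> d i \<le> b" for d
  proof -
    have "norm (0 + (\<Sum>i\<in>I. (d i / b) *\<^sub>R x i)) \<le> B"
      using that b by (intro norm_affine_combination_le fin) (auto simp: sub)
    moreover have "(\<Sum>i\<in>I. d i *\<^sub>R x i) = b *\<^sub>R (\<Sum>i\<in>I. (d i / b) *\<^sub>R x i)"
      using b by (simp add: scaleR_sum_right)
    ultimately show ?thesis using b by (simp add: mult.commute)
  qed
  have real: "norm (\<Sum>i\<in>I. d i *\<^sub>R x i) \<le> 2 * B * b" if "\<And>i. i \<in> I \<Longrightarrow> \<bar>d i\<bar> \<le> b" for d
  proof -
    have "(\<Sum>i\<in>I. d i *\<^sub>R x i) = (\<Sum>i\<in>I. (max 0 (d i) - max 0 (- d i)) *\<^sub>R x i)"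
      by (intro sum.cong) auto
    also have "\<dots> = (\<Sum>i\<in>I. max 0 (d i) *\<^sub>R x i) - (\<Sum>i\<in>I. max 0 (- d i) *\<^sub>R x i)"
      by (simp only: scaleR_left_diff_distrib sum_subtractf)
    also have "norm \<dots> \<le> B * b + B * b"
    proof (intro norm_triangle_le_diff add_mono pos conjI)
      fix i assume "i \<in> I"
      from that[OF this] b show "max 0 (d i) \<le> b" "max 0 (- d i) \<le> b" by auto
    qed auto
    finally show ?thesis by simp
  qed
  have "c i *\<^sub>C x i = Re (c i) *\<^sub>R x i + \<i> *\<^sub>C (Im (c i) *\<^sub>R x i)" for i
    by (simp add: scaleR_scaleC scaleC_scaleC flip: scaleC_add_left complex_eq)
  then have "(\<Sum>i\<in>I. c i *\<^sub>C x i)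
      = (\<Sum>i\<in>I. Re (c i) *\<^sub>R x i) + \<i> *\<^sub>C (\<Sum>i\<in>I. Im (c i) *\<^sub>R x i)"
    by (simp add: sum.distrib scaleC_right_sum)
  also have "norm \<dots> \<le> 2 * B * b + 2 * B * b"
  proof (intro norm_triangle_le add_mono)
    have "\<bar>Re (c i)\<bar> \<le> b" "\<bar>Im (c i)\<bar> \<le> b" if "i \<in> I" for i
      using c[OF that] abs_Re_le_cmod[of "c i"] abs_Im_le_cmod[of "c i"] by linarith+
    then show "norm (\<Sum>i\<in>I. Re (c i) *\<^sub>R x i) \<le> 2 * B * b"
      "norm (\<i> *\<^sub>C (\<Sum>i\<in>I. Im (c i) *\<^sub>R x i)) \<le> 2 * B * b"
      using real by (auto simp: norm_scaleC)
  qed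
  finally show ?thesis by simp
qed

section \<open>Vector measures\<close>

context
  fixes m :: "'a set \<Rightarrow> 'b::real_normed_vector" and M :: "'a measure"
  assumes sums: "\<And>d :: nat \<Rightarrow> 'a set. range d \<subseteq> sets M \<Longrightarrow> disjoint_family d \<Longrightarrow>
    (\<lambda>n. m (d n)) sums m (\<Union>n. d n)"
begin

lemma vector_measure_empty: "m {} = 0"
proof -
  have "(\<lambda>n::nat. m {}) sums m {}"
    using sums[of "\<lambda>_. {}"] by (simp add: disjoint_family_on_def)
  then have "(\<lambda>n::nat. m {}) \<longlonglongrightarrow> 0"
    by (intro summable_LIMSEQ_zero sums_summable)
  then show ?thesis by (simp add: LIMSEQ_const_iff)
qed

lemma vector_measure_Un:
  assumes "a \<in> sets M" "b \<in> sets M" "a \<inter> b = {}"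
  shows "m (a \<union> b) = m a + m b"
proof -
  have "(\<lambda>n. m (binaryset a b n)) sums m (\<Union>n. binaryset a b n)"
    using assms by (intro sums) (auto simp: disjoint_family_on_def binaryset_def)
  moreover have "(\<lambda>n. m (binaryset a b n)) sums (m a + m b)"
    by (rule binaryset_sums) (rule vector_measure_empty)
  ultimately show ?thesis by (simp add: UN_binaryset_eq sums_iff)
qed

lemma vector_measure_finite_UN:
  assumes "finite I" "\<And>i. i \<in> I \<Longrightarrow> d i \<in> sets M" "disjoint_family_on d I"
  shows "m (\<Union>i\<in>I. d i) = (\<Sum>i\<in>I. m (d i))"
  using assms
proof (induction I rule: finite_induct)
  case empty
  then show ?case by (simp add: vector_measure_empty)
next
  case (insert j I)
  then have "m (d j \<union> (\<Union>i\<in>I. d i)) = m (d j) + m (\<Union>i\<in>I. d i)"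
    by (intro vector_measure_Un sets.finite_UN) (auto simp: disjoint_family_on_def)
  then show ?case using insert by (simp add: disjoint_family_on_def)
qed

text \<open>Each \<open>m (\<sigma> n)\<close> is a partial sum of the convergent series over the
  successive differences of the sets.\<close>

lemma vector_measure_tendsto:
  assumes "range \<sigma> \<subseteq> sets M" "mono \<sigma>"
  shows "(\<lambda>n. m (\<sigma> n)) \<longlonglongrightarrow> m (\<Union>n. \<sigma> n)"
proof -
  have d: "range (disjointed \<sigma>) \<subseteq> sets M"
    using sets.range_disjointed_sets[OF assms(1)] .
  have "m (\<sigma> n) = (\<Sum>i<Suc n. m (disjointed \<sigma> i))" for n
  proof -
    have "(\<Sum>i<Suc n. m (disjointed \<sigma> i)) = m (\<Union>i<Suc n. disjointed \<sigma> i)"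
      using d disjoint_family_disjointed[of \<sigma>]
      by (intro vector_measure_finite_UN[symmetric]) (auto simp: disjoint_family_on_def)
    also have "(\<Union>i<Suc n. disjointed \<sigma> i) = (\<Union>i<Suc n. \<sigma> i)"
      using finite_UN_disjointed_eq[of \<sigma> "Suc n"] by (simp only: atLeast0LessThan)
    also have "\<dots> = \<sigma> n"
      using mono_imp_UN_eq_last[OF assms(2), of n] by (simp add: lessThan_Suc_atMost)
    finally show ?thesis by simp
  qed
  moreover have "(\<lambda>n. \<Sum>i<Suc n. m (disjointed \<sigma> i)) \<longlonglongrightarrow> m (\<Union>n. \<sigma> n)"
    using LIMSEQ_Suc[OF sums[OF d disjoint_family_disjointed, unfolded sums_def]]
    by (simp add: UN_disjointed_eq del: sum.lessThan_Suc)
  ultimately show ?thesis by simp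
qed

text \<open>Hahn's splitting argument: a set with unbounded values on its subsets splits into two parts of
  norm greater than 1, one of which is again of this kind. Iterating gives disjoint sets of norm
  greater than 1, against countable additivity.\<close>

lemma vector_measure_bounded: "\<exists>B. \<forall>\<delta>\<in>sets M. norm (m \<delta>) \<le> B"
proof (rule ccontr)
  define unb where
    "unb S \<longleftrightarrow> S \<in> sets M \<and> (\<forall>B. \<exists>\<delta>\<in>sets M. \<delta> \<subseteq> S \<and> norm (m \<delta>) > B)" for S
  have split: "\<exists>S'. unb S' \<and> S' \<subseteq> S \<and> norm (m (S - S')) > 1" if S: "unb S" for S
  proof -
    \<comment> \<open>The margin \<open>1 + norm (m S)\<close> is what makes the complement
      \<open>S - \<delta>\<close> have norm above 1 along with \<open>\<delta>\<close>; either one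
      can then be the discarded part.\<close>
    obtain \<delta> where \<delta>: "\<delta> \<in> sets M" "\<delta> \<subseteq> S" "norm (m \<delta>) > 1 + norm (m S)"
      using S unfolding unb_def by blast
    have SM: "S \<in> sets M" using S by (simp add: unb_def)
    have "m (\<delta> \<union> (S - \<delta>)) = m \<delta> + m (S - \<delta>)"
      using \<delta> SM by (intro vector_measure_Un) auto
    then have "m (S - \<delta>) = m S - m \<delta>"
      using \<delta>(2) by (simp add: Un_absorb1 algebra_simps)
    then have big: "norm (m (S - \<delta>)) > 1"
      using \<delta>(3) norm_triangle_ineq2[of "m \<delta>" "m S"] by (simp add: norm_minus_commute)
    have "unb \<delta> \<or> unb (S - \<delta>)"
    proof (rule ccontr)
      assume "\<not> ?thesis"
      moreover have "S - \<delta> \<in> sets M" using \<delta> SM by blast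
      ultimately obtain B1 B2
        where B1: "\<And>\<eta>. \<eta> \<in> sets M \<Longrightarrow> \<eta> \<subseteq> \<delta> \<Longrightarrow> norm (m \<eta>) \<le> B1"
          and B2: "\<And>\<eta>. \<eta> \<in> sets M \<Longrightarrow> \<eta> \<subseteq> S - \<delta> \<Longrightarrow> norm (m \<eta>) \<le> B2"
        using \<delta>(1) unfolding unb_def by (metis not_le)
      obtain \<eta> where \<eta>: "\<eta> \<in> sets M" "\<eta> \<subseteq> S" "norm (m \<eta>) > B1 + B2"
        using S unfolding unb_def by blast
      have "m ((\<eta> \<inter> \<delta>) \<union> (\<eta> - \<delta>)) = m (\<eta> \<inter> \<delta>) + m (\<eta> - \<delta>)"
        using \<eta> \<delta> by (intro vector_measure_Un) auto
      moreover have "(\<eta> \<inter> \<delta>) \<union> (\<eta> - \<delta>) = \<eta>" by blast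
      moreover have "norm (m (\<eta> \<inter> \<delta>)) \<le> B1" "norm (m (\<eta> - \<delta>)) \<le> B2"
        using \<eta> \<delta> by (auto intro!: B1 B2)
      ultimately show False
        using \<eta>(3) norm_triangle_ineq[of "m (\<eta> \<inter> \<delta>)" "m (\<eta> - \<delta>)"] by simp
    qed
    then show ?thesis
    proof
      assume "unb \<delta>"
      then show ?thesis using big \<delta>(2) by blast
    next
      assume "unb (S - \<delta>)"
      moreover have "S - (S - \<delta>) = \<delta>" using \<delta>(2) by blast
      moreover have "norm (m \<delta>) > 1" using \<delta>(3) norm_ge_zero[of "m S"] by linarith
      ultimately show ?thesis by (intro exI[of _ "S - \<delta>"]) auto
    qed
  qed
  assume "\<not> ?thesis"
  then have "unb (space M)"
    unfolding unb_def by (metis not_le sets.sets_into_space sets.top)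
  then obtain S where S: "\<And>n. unb (S n) \<and> S (Suc n) \<subseteq> S n \<and> norm (m (S n - S (Suc n))) > 1"
    using dependent_nat_choice[of "\<lambda>_. unb" "\<lambda>_ S S'. S' \<subseteq> S \<and> norm (m (S - S')) > 1"] split
    by metis
  define d where "d n = S n - S (Suc n)" for n
  have "decseq S" using S by (intro decseq_SucI) blast
  have "d i \<inter> d j = {}" if "i < j" for i j
    using decseqD[OF \<open>decseq S\<close>, of "Suc i" j] that by (auto simp: d_def)
  then have "disjoint_family d"
    by (simp add: disjoint_family_on_def) (metis Int_commute linorder_neqE_nat)
  moreover have "range d \<subseteq> sets M" using S by (auto simp: d_def unb_def)
  ultimately have "(\<lambda>n. m (d n)) \<longlonglongrightarrow> 0"
    by (intro summable_LIMSEQ_zero sums_summable[OF sums])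
  then obtain n where "norm (m (d n)) < 1"
    using LIMSEQ_D[of _ 0 1] by fastforce
  then show False using S[of n] by (simp add: d_def)
qed

end

text \<open>Strong countable additivity bounds \<open>E \<delta> f\<close> over all Borel
  \<open>\<delta>\<close> for each fixed \<open>f\<close>; uniform boundedness makes the constant
  independent of \<open>f\<close>.\<close>

lemma spectral_measure_bounded:
  assumes "spectral_measure E"
  shows "\<exists>K\<ge>0. \<forall>\<delta>\<in>sets borel. \<forall>f. norm (E \<delta> f) \<le> K * norm f"
proof (rule uniform_boundedness)
  show "bounded_linear (E \<delta>)" if "\<delta> \<in> sets borel" for \<delta>
    using that assms by (simp add: spectral_measure_def bounded_clinear_def)
  show "\<exists>B. \<forall>\<delta>\<in>sets borel. norm (E \<delta> f) \<le> B" for f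
    using assms by (intro vector_measure_bounded) (simp add: spectral_measure_def)
qed

section \<open>Approximation by simple functions\<close>

lemma le_of_vanishing_error:
  fixes x y D :: real
  assumes "\<And>e. 0 < e \<Longrightarrow> e \<le> 1 \<Longrightarrow> x \<le> y + D * e"
  shows "x \<le> y"
proof (rule tendsto_le)
  have "((\<lambda>e. y + D * e) \<longlongrightarrow> y + D * 0) (at_right 0)"
    by (intro tendsto_intros)
  then show "((\<lambda>e. y + D * e) \<longlongrightarrow> y) (at_right 0)" by simp
  show "((\<lambda>_. x) \<longlongrightarrow> x) (at_right (0::real))" by simp
  show "\<forall>\<^sub>F e in at_right 0. x \<le> y + D * e"
    by (rule eventually_at_rightI[of 0 1]) (auto intro: assms)
qed simp

text \<open>Real and imaginary parts are rounded down to a grid of mesh \<open>e / 2\<close>, so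
  that the two errors add up to at most \<open>e\<close>. Boundedness of \<open>G\<close> leaves
  only finitely many grid points.\<close>

lemma uniformly_approximable_by_simple_function:
  assumes [measurable]: "G \<in> borel_measurable M" and B: "\<And>z. cmod (G z) \<le> B" and e: "e > 0"
  shows "\<exists>s. simple_function M s \<and> (\<forall>z. cmod (s z - G z) \<le> e)"
proof -
  define s where "s z = of_real (e / 2 * of_int \<lfloor>2 * Re (G z) / e\<rfloor>)
    + \<i> * of_real (e / 2 * of_int \<lfloor>2 * Im (G z) / e\<rfloor>)" for z
  define N where "N = \<lceil>2 * B / e\<rceil> + 1"
  have round: "\<bar>e / 2 * of_int \<lfloor>2 * x / e\<rfloor> - x\<bar> \<le> e / 2" for x
  proof -
    have "x = e / 2 * (2 * x / e)" using e by simp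
    then have "e / 2 * of_int \<lfloor>2 * x / e\<rfloor> - x = e / 2 * (of_int \<lfloor>2 * x / e\<rfloor> - 2 * x / e)"
      by (metis right_diff_distrib)
    then have "\<bar>e / 2 * of_int \<lfloor>2 * x / e\<rfloor> - x\<bar> = e / 2 * \<bar>of_int \<lfloor>2 * x / e\<rfloor> - 2 * x / e\<bar>"
      using e by (simp only: abs_mult)
    also have "\<dots> \<le> e / 2 * 1"
      using e by (intro mult_left_mono) linarith+
    finally show ?thesis by simp
  qed
  have range: "\<lfloor>2 * x / e\<rfloor> \<in> {-N..N}" if "\<bar>x\<bar> \<le> B" for x
  proof -
    have "\<bar>2 * x / e\<bar> \<le> 2 * B / e" using that e by (simp add: abs_mult divide_right_mono)
    then show ?thesis unfolding N_def by (auto; linarith)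
  qed
  have "finite (s ` space M)"
  proof (rule finite_subset)
    show "s ` space M \<subseteq> (\<lambda>(i, j). of_real (e / 2 * of_int i) + \<i> * of_real (e / 2 * of_int j))
      ` ({-N..N} \<times> {-N..N})"
    proof
      fix w assume "w \<in> s ` space M"
      then obtain z where z: "w = s z" by blast
      have "(\<lfloor>2 * Re (G z) / e\<rfloor>, \<lfloor>2 * Im (G z) / e\<rfloor>) \<in> {-N..N} \<times> {-N..N}"
        using range B order_trans[OF abs_Re_le_cmod] order_trans[OF abs_Im_le_cmod] by blast
      then show "w \<in> (\<lambda>(i, j). of_real (e / 2 * of_int i) + \<i> * of_real (e / 2 * of_int j))
        ` ({-N..N} \<times> {-N..N})"
        unfolding z s_def by (rule rev_image_eqI) simp
    qed
  qed simp
  then have "simple_function M s"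
    by (intro simple_function_borel_measurable) (simp_all add: s_def[abs_def])
  moreover have "cmod (s z - G z) \<le> e" for z
  proof -
    have "cmod (s z - G z) \<le> \<bar>Re (s z - G z)\<bar> + \<bar>Im (s z - G z)\<bar>" by (rule cmod_le)
    also have "\<dots> \<le> e / 2 + e / 2"
      using round[of "Re (G z)"] round[of "Im (G z)"] by (intro add_mono) (simp_all add: s_def)
    finally show ?thesis by simp
  qed
  ultimately show ?thesis by blast
qed

section \<open>Integrals of bounded functions\<close>

locale bounded_spectral_measure =
  fixes E :: "complex set \<Rightarrow> 'a::complex_banach \<Rightarrow> 'a" and K :: real
  assumes spectral_measure: "spectral_measure E"
    and K_nonneg: "K \<ge> 0"
    and norm_E_le: "\<And>\<delta> f. \<delta> \<in> sets borel \<Longrightarrow> norm (E \<delta> f) \<le> K * norm f"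
begin

abbreviation S where "S \<equiv> simple_spectral_integral E"
abbreviation T where "T \<equiv> bounded_spectral_integral E"

lemma bounded_linear_E: "\<delta> \<in> sets borel \<Longrightarrow> bounded_linear (E \<delta>)"
  and E_scaleC: "\<delta> \<in> sets borel \<Longrightarrow> E \<delta> (c *\<^sub>C f) = c *\<^sub>C E \<delta> f"
  and E_UNIV: "E UNIV f = f"
  and E_Int: "\<delta> \<in> sets borel \<Longrightarrow> \<sigma> \<in> sets borel \<Longrightarrow> E (\<delta> \<inter> \<sigma>) f = E \<delta> (E \<sigma> f)"
  using spectral_measure by (auto simp: spectral_measure_def bounded_clinear_def fun_eq_iff)

lemma E_sums:
  "range (d :: nat \<Rightarrow> complex set) \<subseteq> sets borel \<Longrightarrow> disjoint_family d \<Longrightarrow>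
    (\<lambda>n. E (d n) f) sums E (\<Union>n. d n) f"
  using spectral_measure by (auto simp: spectral_measure_def)

lemmas E_empty [simp] = vector_measure_empty[where M = borel and m = "\<lambda>d. E d f" for f, OF E_sums]
  and E_finite_UN = vector_measure_finite_UN[where M = borel and m = "\<lambda>d. E d f" for f, OF E_sums]
  and E_tendsto_UN = vector_measure_tendsto[where M = borel and m = "\<lambda>d. E d f" for f, OF E_sums]

lemma E_sum: "\<delta> \<in> sets borel \<Longrightarrow> E \<delta> (\<Sum>i\<in>I. x i) = (\<Sum>i\<in>I. E \<delta> (x i))"
  by (rule linear_sum[OF bounded_linear.linear[OF bounded_linear_E]])

section \<open>Integrals of simple functions\<close>

lemma simple_vimage_borel: "simple_function borel p \<Longrightarrow> p -` J \<in> sets borel"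
  using simple_functionD(2)[of borel p J] by simp

lemma simple_finite_range: "simple_function borel p \<Longrightarrow> finite (range p)"
  using simple_functionD(1)[of borel p] by simp

lemma E_vimage_finite:
  assumes "simple_function borel p" "finite J"
  shows "E (p -` J) f = (\<Sum>v\<in>J. E (p -` {v}) f)"
proof -
  have "E (\<Union>v\<in>J. p -` {v}) f = (\<Sum>v\<in>J. E (p -` {v}) f)"
    using assms by (intro E_finite_UN simple_vimage_borel) (auto simp: disjoint_family_on_def)
  moreover have "(\<Union>v\<in>J. p -` {v}) = p -` J" by blast
  ultimately show ?thesis by simp
qed

text \<open>Two simple functions are compared by taking \<open>p\<close> to be their pair: both are
  then integrated over the same partition into fibres of \<open>p\<close>. A larger \<open>W\<close>
  is allowed because values outside the range of \<open>p\<close> have empty fibres.\<close>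

lemma S_comp:
  assumes p: "simple_function borel p" and W: "finite W" "range p \<subseteq> W"
  shows "S (\<lambda>z. \<phi> (p z)) f = (\<Sum>v\<in>W. \<phi> v *\<^sub>C E (p -` {v}) f)"
proof -
  let ?s = "\<lambda>z. \<phi> (p z)"
  have "E (?s -` {c}) f = (\<Sum>v\<in>{v\<in>W. \<phi> v = c}. E (p -` {v}) f)" for c
  proof -
    have "?s -` {c} = p -` {v\<in>W. \<phi> v = c}" using W(2) by auto
    moreover have "finite {v\<in>W. \<phi> v = c}" using W(1) by simp
    ultimately show ?thesis by (simp only: E_vimage_finite[OF p])
  qed
  then have "S ?s f = (\<Sum>c\<in>range ?s. \<Sum>v\<in>{v\<in>W. \<phi> v = c}. \<phi> v *\<^sub>C E (p -` {v}) f)"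
    unfolding simple_spectral_integral_def by (simp add: scaleC_right_sum)
  also have "\<dots> = (\<Sum>c\<in>\<phi> ` W. \<Sum>v\<in>{v\<in>W. \<phi> v = c}. \<phi> v *\<^sub>C E (p -` {v}) f)"
  proof (intro sum.mono_neutral_left ballI sum.neutral)
    fix c v assume "c \<in> \<phi> ` W - range ?s" "v \<in> {v\<in>W. \<phi> v = c}"
    then have "\<phi> v \<notin> range ?s" by auto
    then have "p -` {v} = {}" by auto
    then show "\<phi> v *\<^sub>C E (p -` {v}) f = 0" by simp
  qed (use W in auto)
  also have "\<dots> = (\<Sum>v\<in>W. \<phi> v *\<^sub>C E (p -` {v}) f)"
    by (rule sum.image_gen[OF W(1), symmetric])
  finally show ?thesis .
qed

lemma S_indicator:
  assumes "\<sigma> \<in> sets borel"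
  shows "S (indicator \<sigma>) f = E \<sigma> f"
proof -
  have "simple_function borel (\<lambda>z. z \<in> \<sigma>)"
  proof -
    have "finite (range (\<lambda>z. z \<in> \<sigma>))" by (rule finite)
    then show ?thesis using assms by (simp add: simple_function_eq_measurable)
  qed
  from S_comp[OF this finite subset_UNIV, of of_bool f]
  have "S (\<lambda>z. of_bool (z \<in> \<sigma>)) f = E ((\<lambda>z. z \<in> \<sigma>) -` {True}) f"
    by (simp add: UNIV_bool)
  moreover have "(\<lambda>z. of_bool (z \<in> \<sigma>)) = (indicator \<sigma> :: complex \<Rightarrow> complex)"
    by (auto simp: indicator_def)
  ultimately show ?thesis by (simp add: vimage_def)
qed

lemma S_diff:
  assumes "simple_function borel s" "simple_function borel t"
  shows "S (\<lambda>z. s z - t z) f = S s f - S t f"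
proof -
  let ?p = "\<lambda>z. (s z, t z)"
  have p: "simple_function borel ?p" using assms by (rule simple_function_Pair)
  note * = S_comp[OF p simple_finite_range[OF p] order_refl]
  show ?thesis
    using *[of "\<lambda>(x, y). x - y" f] *[of fst f] *[of snd f]
    by (simp add: scaleC_diff_left sum_subtractf case_prod_beta)
qed

text \<open>Multiplicativity \<open>E (\<delta> \<inter> \<sigma>) = E \<delta> \<circ> E
  \<sigma>\<close> turns the composed double sum into a sum over the fibres of the pair.\<close>

lemma S_mult:
  assumes s: "simple_function borel s" and t: "simple_function borel t"
  shows "S (\<lambda>z. s z * t z) f = S s (S t f)"
proof -
  let ?p = "\<lambda>z. (s z, t z)"
  have "S s (S t f) = (\<Sum>c\<in>range s. \<Sum>d\<in>range t. (c * d) *\<^sub>C E (s -` {c}) (E (t -` {d}) f))"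
    unfolding simple_spectral_integral_def
    by (simp add: E_sum E_scaleC simple_vimage_borel s t scaleC_right_sum scaleC_scaleC)
  also have "\<dots> = (\<Sum>c\<in>range s. \<Sum>d\<in>range t. (c * d) *\<^sub>C E (?p -` {(c, d)}) f)"
  proof (intro sum.cong refl)
    fix c d
    have "?p -` {(c, d)} = s -` {c} \<inter> t -` {d}" by auto
    then show "(c * d) *\<^sub>C E (s -` {c}) (E (t -` {d}) f) = (c * d) *\<^sub>C E (?p -` {(c, d)}) f"
      by (simp add: E_Int simple_vimage_borel s t)
  qed
  also have "\<dots> = (\<Sum>v\<in>range s \<times> range t. (fst v * snd v) *\<^sub>C E (?p -` {v}) f)"
    by (simp add: sum.cartesian_product case_prod_beta)
  also have "\<dots> = S (\<lambda>z. s z * t z) f"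
  proof -
    have "range ?p \<subseteq> range s \<times> range t" by auto
    moreover have "finite (range s \<times> range t)" by (simp add: simple_finite_range s t)
    ultimately show ?thesis
      using S_comp[OF simple_function_Pair[OF s t], of "range s \<times> range t" "\<lambda>v. fst v * snd v" f]
      by simp
  qed
  finally show ?thesis by simp
qed

lemma norm_S_le:
  assumes s: "simple_function borel s" and b: "\<And>z. cmod (s z) \<le> b"
  shows "norm (S s f) \<le> 4 * K * b * norm f"
proof -
  have "norm (S s f) \<le> 4 * (K * norm f) * b"
    unfolding simple_spectral_integral_def
  proof (rule norm_complex_combination_le)
    show "norm (\<Sum>c\<in>J. E (s -` {c}) f) \<le> K * norm f" if "J \<subseteq> range s" for J
      using E_vimage_finite[OF s finite_subset[OF that], of f] norm_E_le[of "s -` J" f]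
      by (simp add: simple_finite_range simple_vimage_borel s)
    show "b \<ge> 0" using b[of 0] norm_ge_zero order_trans by blast
  qed (use b s in \<open>auto simp: simple_finite_range\<close>)
  then show ?thesis by (simp add: mult_ac)
qed

lemma bounded_clinear_S:
  assumes s: "simple_function borel s"
  shows "bounded_clinear (S s)"
proof -
  have "bounded_linear (S s)"
    unfolding simple_spectral_integral_def
    by (intro bounded_linear_sum bounded_linear_compose[OF bounded_linear_scaleC]
        bounded_linear_E simple_vimage_borel s)
  moreover have "S s (c *\<^sub>C f) = c *\<^sub>C S s f" for c f
    unfolding simple_spectral_integral_def
    by (simp add: E_scaleC simple_vimage_borel s scaleC_right_sum scaleC_scaleC mult.commute)
  ultimately show ?thesis by (simp add: bounded_clinear_def)
qed

section \<open>Integrals of bounded Borel functions\<close>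

lemma bounded_integral_exists:
  assumes G: "G \<in> borel_measurable borel" and B: "\<And>z. cmod (G z) \<le> B"
  shows "\<exists>T. bounded_clinear T \<and> (\<forall>s e f. simple_function borel s \<longrightarrow> (\<forall>z. cmod (s z - G z) \<le> e) \<longrightarrow>
    norm (S s f - T f) \<le> 4 * K * e * norm f)"
proof -
  have "\<exists>s. simple_function borel s \<and> (\<forall>z. cmod (s z - G z) \<le> 1 / Suc n)" for n
    by (rule uniformly_approximable_by_simple_function[OF G B]) simp
  then obtain u where u: "\<And>n. simple_function borel (u n)"
    and uG: "\<And>n z. cmod (u n z - G z) \<le> 1 / Suc n" by metis
  have close: "norm (S s f - S (u n) f) \<le> 4 * K * (e + 1 / Suc n) * norm f"
    if "simple_function borel s" "\<And>z. cmod (s z - G z) \<le> e" for s e f n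
  proof -
    \<comment> \<open>The triangle inequality through \<open>G\<close>. Taking
      \<open>s = u m\<close> gives the Cauchy property; letting \<open>n\<close> tend to infinity
      gives the estimate for an arbitrary \<open>s\<close>, with a limit operator independent of
      \<open>s\<close>.\<close>
    have "cmod (s z - u n z) \<le> e + 1 / Suc n" for z
      using norm_triangle_mono[OF that(2)[of z], of "G z - u n z" "1 / Suc n"] uG[of n z]
      by (simp add: norm_minus_commute)
    then have "norm (S (\<lambda>z. s z - u n z) f) \<le> 4 * K * (e + 1 / Suc n) * norm f"
      by (intro norm_S_le simple_function_diff that u)
    then show ?thesis by (simp add: S_diff that u)
  qed
  have null: "(\<lambda>n. 1 / real (Suc n)) \<longlonglongrightarrow> 0"
    using LIMSEQ_inverse_real_of_nat by (simp add: inverse_eq_divide)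
  have "Cauchy (\<lambda>n. S (u n) f)" for f
  proof (rule metric_CauchyI)
    fix \<epsilon> :: real assume "\<epsilon> > 0"
    have "(\<lambda>n. 4 * K * (1 / real (Suc n) + 1 / real (Suc n)) * norm f) \<longlonglongrightarrow> 4 * K * (0 + 0) * norm f"
      by (intro tendsto_intros null)
    then have "\<forall>\<^sub>F n in sequentially. 4 * K * (1 / real (Suc n) + 1 / real (Suc n)) * norm f < \<epsilon>"
      using \<open>\<epsilon> > 0\<close> by (intro order_tendstoD) auto
    then obtain N where N: "4 * K * (1 / real (Suc N) + 1 / real (Suc N)) * norm f < \<epsilon>"
      by (auto simp: eventually_sequentially)
    have "dist (S (u m) f) (S (u n) f) < \<epsilon>" if "m \<ge> N" "n \<ge> N" for m n
    proof -
      have "dist (S (u m) f) (S (u n) f) \<le> 4 * K * (1 / Suc m + 1 / Suc n) * norm f"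
        unfolding dist_norm by (intro close u uG)
      also have "\<dots> \<le> 4 * K * (1 / Suc N + 1 / Suc N) * norm f"
        using that K_nonneg
        by (intro mult_right_mono mult_left_mono add_mono divide_left_mono) auto
      finally show ?thesis using N by simp
    qed
    then show "\<exists>N. \<forall>m\<ge>N. \<forall>n\<ge>N. dist (S (u m) f) (S (u n) f) < \<epsilon>" by blast
  qed
  then obtain T where T: "\<And>f. (\<lambda>n. S (u n) f) \<longlonglongrightarrow> T f"
    unfolding Cauchy_convergent_iff convergent_def by metis
  have approx: "norm (S s f - T f) \<le> 4 * K * e * norm f"
    if "simple_function borel s" "\<And>z. cmod (s z - G z) \<le> e" for s e f
  proof (rule tendsto_le)
    show "(\<lambda>n. norm (S s f - S (u n) f)) \<longlonglongrightarrow> norm (S s f - T f)"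
      by (intro tendsto_intros T)
    have "(\<lambda>n. 4 * K * (e + 1 / real (Suc n)) * norm f) \<longlonglongrightarrow> 4 * K * (e + 0) * norm f"
      by (intro tendsto_intros null)
    then show "(\<lambda>n. 4 * K * (e + 1 / real (Suc n)) * norm f) \<longlonglongrightarrow> 4 * K * e * norm f" by simp
  qed (use close[OF that] in auto)
  have lin: "linear (S (u n))" and scaleC: "S (u n) (c *\<^sub>C f) = c *\<^sub>C S (u n) f" for n c f
    using bounded_clinear_S[OF u] by (auto simp: bounded_clinear_def bounded_linear.linear)
  have "bounded_linear T"
  proof (rule bounded_linear_intro)
    show "T (f + g) = T f + T g" for f g
      using tendsto_add[OF T[of f] T[of g]]
      by (intro LIMSEQ_unique[OF T]) (simp add: linear_add[OF lin])
    show "T (r *\<^sub>R f) = r *\<^sub>R T f" for r f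
      using tendsto_scaleR[OF tendsto_const T[of f]]
      by (intro LIMSEQ_unique[OF T]) (simp add: linear_scale[OF lin])
    \<comment> \<open>\<open>u 0\<close> is within distance 1 of \<open>G\<close>, so boundedness of
      the limit operator is inherited from that single integral.\<close>
    have uB: "cmod (u 0 z) \<le> B + 1" for z
      using norm_triangle_mono[OF uG[of 0 z] B[of z]] by simp
    show "norm (T f) \<le> norm f * (4 * K * (B + 1) + 4 * K)" for f
    proof -
      have "norm (S (u 0) f - T f) \<le> 4 * K * 1 * norm f"
        using approx[OF u uG, of 0 f] by simp
      moreover have "norm (S (u 0) f) \<le> 4 * K * (B + 1) * norm f"
        by (intro norm_S_le u uB)
      ultimately show ?thesis
        using norm_triangle_sub[of "T f" "S (u 0) f"] by (simp add: norm_minus_commute algebra_simps)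
    qed
  qed
  moreover have "T (c *\<^sub>C f) = c *\<^sub>C T f" for c f
    using bounded_linear.tendsto[OF bounded_linear_scaleC T[of f]]
    by (intro LIMSEQ_unique[OF T]) (simp add: scaleC)
  ultimately show ?thesis using approx by (intro exI[of _ T]) (simp add: bounded_clinear_def)
qed

text \<open>This resolves the definite description and replaces limits in operator norm by an
  explicit error estimate, the form used from here on.\<close>

lemma
  assumes G: "G \<in> borel_measurable borel" and B: "\<And>z. cmod (G z) \<le> B"
  shows bounded_clinear_T: "bounded_clinear (T G)"
    and norm_S_minus_T_le: "\<And>s e f. simple_function borel s \<Longrightarrow> (\<And>z. cmod (s z - G z) \<le> e) \<Longrightarrow>
      norm (S s f - T G f) \<le> 4 * K * e * norm f"
proof -
  obtain U where U: "bounded_clinear U"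
    and approx: "\<And>s e f. simple_function borel s \<Longrightarrow> (\<And>z. cmod (s z - G z) \<le> e) \<Longrightarrow>
      norm (S s f - U f) \<le> 4 * K * e * norm f"
    using bounded_integral_exists[OF assms] by metis
  have conv: "(\<lambda>n. onorm (\<lambda>f. S (s n) f - U f)) \<longlonglongrightarrow> 0"
    if s: "\<And>n. simple_function borel (s n)" and unif: "uniform_limit UNIV s G sequentially" for s
  proof (rule LIMSEQ_I)
    fix \<epsilon> :: real assume \<epsilon>: "\<epsilon> > 0"
    \<comment> \<open>The denominator \<open>4 * K + 1\<close> stays positive even if
      \<open>K = 0\<close> and makes the inequality below strict.\<close>
    define e where "e = \<epsilon> / (4 * K + 1)"
    have e: "e > 0" using \<epsilon> K_nonneg by (simp add: e_def)
    have "4 * K * e < (4 * K + 1) * e" using e by (simp add: algebra_simps)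
    also have "\<dots> = \<epsilon>" using K_nonneg by (simp add: e_def)
    finally have small: "4 * K * e < \<epsilon>" .
    obtain N where N: "\<And>n z. n \<ge> N \<Longrightarrow> dist (s n z) (G z) < e"
      using uniform_limitD[OF unif e] by (auto simp: eventually_sequentially)
    have "norm (onorm (\<lambda>f. S (s n) f - U f) - 0) < \<epsilon>" if "n \<ge> N" for n
    proof -
      have "cmod (s n z - G z) \<le> e" for z using N[OF that, of z] by (simp add: dist_norm)
      then have "onorm (\<lambda>f. S (s n) f - U f) \<le> 4 * K * e"
        using e K_nonneg by (intro onorm_bound approx s) auto
      moreover have "0 \<le> onorm (\<lambda>f. S (s n) f - U f)"
        using U bounded_clinear_S[OF s]
        by (intro onorm_pos_le bounded_linear_sub) (auto simp: bounded_clinear_def)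
      ultimately show ?thesis using small by simp
    qed
    then show "\<exists>N. \<forall>n\<ge>N. norm (onorm (\<lambda>f. S (s n) f - U f) - 0) < \<epsilon>" by blast
  qed
  have "T G = U"
    unfolding bounded_spectral_integral_def
  proof (rule the_equality)
    fix V
    assume V: "bounded_clinear V \<and> (\<forall>s. (\<forall>n. simple_function borel (s n)) \<longrightarrow>
      uniform_limit UNIV s G sequentially \<longrightarrow> (\<lambda>n. onorm (\<lambda>f. S (s n) f - V f)) \<longlonglongrightarrow> 0)"
    \<comment> \<open>Uniqueness: along one uniformly convergent sequence \<open>u\<close>, the
      integrals \<open>S (u n) f\<close> tend both to \<open>V f\<close> and to
      \<open>U f\<close>.\<close>
    have "\<exists>s. simple_function borel s \<and> (\<forall>z. cmod (s z - G z) \<le> 1 / Suc n)" for n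
      by (rule uniformly_approximable_by_simple_function[OF G B]) simp
    then obtain u where u: "\<And>n. simple_function borel (u n)"
      and uG: "\<And>n z. cmod (u n z - G z) \<le> 1 / Suc n" by metis
    have unif: "uniform_limit UNIV u G sequentially"
    proof (rule uniform_limitI)
      fix e :: real assume "e > 0"
      then obtain N where N: "1 / real (Suc N) < e" using nat_approx_posE by blast
      have "dist (u n z) (G z) < e" if "n \<ge> N" for n z
      proof -
        have "1 / real (Suc n) \<le> 1 / real (Suc N)" using that by (intro divide_left_mono) auto
        then show ?thesis using uG[of n z] N by (simp add: dist_norm)
      qed
      then show "\<forall>\<^sub>F n in sequentially. \<forall>z\<in>UNIV. dist (u n z) (G z) < e"
        by (auto simp: eventually_sequentially)
    qed
    have lim: "(\<lambda>n. S (u n) f) \<longlonglongrightarrow> W f"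
      if W: "bounded_clinear W" and 0: "(\<lambda>n. onorm (\<lambda>f. S (u n) f - W f)) \<longlonglongrightarrow> 0" for W f
    proof -
      have "norm (S (u n) f - W f) \<le> onorm (\<lambda>f. S (u n) f - W f) * norm f" for n
        using W bounded_clinear_S[OF u]
        by (intro onorm[of "\<lambda>f. S (u n) f - W f"] bounded_linear_sub)
          (auto simp: bounded_clinear_def)
      moreover have "(\<lambda>n. onorm (\<lambda>f. S (u n) f - W f) * norm f) \<longlonglongrightarrow> 0"
        using tendsto_mult_left_zero[OF 0] .
      ultimately have "(\<lambda>n. S (u n) f - W f) \<longlonglongrightarrow> 0"
        by (rule Lim_null_comparison[OF always_eventually[OF allI]])
      then show ?thesis by (simp add: LIM_zero_iff)
    qed
    show "V = U"
    proof
      fix f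
      have "(\<lambda>n. onorm (\<lambda>f. S (u n) f - V f)) \<longlonglongrightarrow> 0" using V u unif by blast
      then have "(\<lambda>n. S (u n) f) \<longlonglongrightarrow> V f" by (intro lim conjunct1[OF V])
      moreover have "(\<lambda>n. S (u n) f) \<longlonglongrightarrow> U f" by (intro lim U conv u unif)
      ultimately show "V f = U f" by (rule LIMSEQ_unique)
    qed
  qed (use U conv in auto)
  then show "bounded_clinear (T G)"
    and "\<And>s e f. simple_function borel s \<Longrightarrow> (\<And>z. cmod (s z - G z) \<le> e) \<Longrightarrow>
      norm (S s f - T G f) \<le> 4 * K * e * norm f"
    using U approx by auto
qed

lemma norm_T_le:
  assumes G: "G \<in> borel_measurable borel" and B: "\<And>z. cmod (G z) \<le> B"
  shows "norm (T G f) \<le> 4 * K * B * norm f"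
proof (rule le_of_vanishing_error)
  fix e :: real assume e: "e > 0"
  obtain s where s: "simple_function borel s" "\<And>z. cmod (s z - G z) \<le> e"
    using uniformly_approximable_by_simple_function[OF G B e] by blast
  have "cmod (s z) \<le> e + B" for z
    using norm_triangle_mono[OF s(2)[of z] B[of z]] by simp
  then have "norm (S s f) \<le> 4 * K * (e + B) * norm f" by (intro norm_S_le s)
  moreover have "norm (S s f - T G f) \<le> 4 * K * e * norm f"
    by (rule norm_S_minus_T_le[OF G B s])
  ultimately show "norm (T G f) \<le> 4 * K * B * norm f + 8 * K * norm f * e"
    using norm_triangle_sub[of "T G f" "S s f"] by (simp add: norm_minus_commute algebra_simps)
qed

lemma T_indicator:
  assumes "\<sigma> \<in> sets borel"
  shows "T (indicator \<sigma>) f = E \<sigma> f"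
proof -
  have "simple_function borel (indicator \<sigma> :: complex \<Rightarrow> complex)"
  proof (rule simple_function_borel_measurable)
    show "finite (indicator \<sigma> ` space borel :: complex set)"
      by (rule finite_subset[of _ "{0, 1}"]) (auto simp: indicator_def)
  qed (use assms in simp)
  \<comment> \<open>The indicator is simple, hence approximates itself with error 0.\<close>
  then have "norm (S (indicator \<sigma>) f - T (indicator \<sigma>) f) \<le> 4 * K * 0 * norm f"
    using assms by (intro norm_S_minus_T_le[where B = 1]) (auto simp: indicator_def)
  then show ?thesis by (simp add: S_indicator assms)
qed

text \<open>Both factors are approximated by simple functions, for which the identity is
  \<open>S_mult\<close>. The three terms of \<open>D\<close> are the costs of replacing the product,
  the inner integral and the outer integral.\<close>

lemma T_mult:
  assumes G: "G \<in> borel_measurable borel" and B: "\<And>z. cmod (G z) \<le> B"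
    and H: "H \<in> borel_measurable borel" and C: "\<And>z. cmod (H z) \<le> C"
  shows "T (\<lambda>z. G z * H z) f = T G (T H f)"
proof -
  define D where
    "D = 4 * K * (B + 1 + C) * norm f + 4 * K * (B + 1) * (4 * K * norm f) + 4 * K * norm (T H f)"
  have GH: "(\<lambda>z. G z * H z) \<in> borel_measurable borel" using G H by measurable
  have "B \<ge> 0" "C \<ge> 0" using order_trans[OF norm_ge_zero B] order_trans[OF norm_ge_zero C] by auto
  then have BC: "cmod (G z * H z) \<le> B * C" for z
    unfolding norm_mult by (intro mult_mono B C) auto
  have "norm (T (\<lambda>z. G z * H z) f - T G (T H f)) \<le> 0"
  proof (rule le_of_vanishing_error)
    fix e :: real assume e: "0 < e" "e \<le> 1"
    obtain u where u: "simple_function borel u" "\<And>z. cmod (u z - G z) \<le> e"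
      using uniformly_approximable_by_simple_function[OF G B e(1)] by blast
    obtain v where v: "simple_function borel v" "\<And>z. cmod (v z - H z) \<le> e"
      using uniformly_approximable_by_simple_function[OF H C e(1)] by blast
    \<comment> \<open>Here \<open>e \<le> 1\<close> makes the bound independent of \<open>e\<close>,
      so that the total error remains linear in \<open>e\<close>.\<close>
    have uB: "cmod (u z) \<le> B + 1" for z
      using norm_triangle_mono[OF u(2)[of z] B[of z]] e(2) by simp
    have "cmod (u z * v z - G z * H z) \<le> (B + 1 + C) * e" for z
    proof -
      have "u z * v z - G z * H z = u z * (v z - H z) + (u z - G z) * H z"
        by (simp add: algebra_simps)
      also have "cmod \<dots> \<le> cmod (u z) * cmod (v z - H z) + cmod (u z - G z) * cmod (H z)"
        by (rule norm_triangle_mono) (simp_all add: norm_mult)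
      also have "\<dots> \<le> (B + 1) * e + e * C"
        using e \<open>B \<ge> 0\<close> by (intro add_mono mult_mono u v uB C) simp_all
      finally show ?thesis by (simp add: algebra_simps)
    qed
    then have 1: "norm (S (\<lambda>z. u z * v z) f - T (\<lambda>z. G z * H z) f) \<le> 4 * K * ((B + 1 + C) * e) * norm f"
      by (intro norm_S_minus_T_le[OF GH BC] simple_function_mult u v)
    have lin: "linear (S u)"
      using bounded_clinear_S[OF u(1)] by (simp add: bounded_clinear_def bounded_linear.linear)
    have "norm (S u (S v f - T H f)) \<le> 4 * K * (B + 1) * norm (S v f - T H f)"
      by (intro norm_S_le u uB)
    also have "\<dots> \<le> 4 * K * (B + 1) * (4 * K * e * norm f)"
      using K_nonneg \<open>B \<ge> 0\<close> by (intro mult_left_mono norm_S_minus_T_le[OF H C v]) auto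
    finally have 2: "norm (S u (S v f) - S u (T H f)) \<le> 4 * K * (B + 1) * (4 * K * e * norm f)"
      by (simp add: linear_diff[OF lin])
    have 3: "norm (S u (T H f) - T G (T H f)) \<le> 4 * K * e * norm (T H f)"
      by (rule norm_S_minus_T_le[OF G B u])
    have "T (\<lambda>z. G z * H z) f - T G (T H f) = - (S (\<lambda>z. u z * v z) f - T (\<lambda>z. G z * H z) f)
        + ((S u (S v f) - S u (T H f)) + (S u (T H f) - T G (T H f)))"
      by (simp add: S_mult[OF u(1) v(1)])
    also have "norm \<dots> \<le> 4 * K * ((B + 1 + C) * e) * norm f
        + (4 * K * (B + 1) * (4 * K * e * norm f) + 4 * K * e * norm (T H f))"
      by (rule norm_triangle_mono[OF _ norm_triangle_mono[OF 2 3]]) (simp only: norm_minus_cancel 1)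
    also have "\<dots> = 0 + D * e" by (simp add: D_def algebra_simps)
    finally show "norm (T (\<lambda>z. G z * H z) f - T G (T H f)) \<le> 0 + D * e" .
  qed
  then show ?thesis by simp
qed

end

section \<open>Integrals of unbounded functions\<close>

lemma option_eqI: "(\<And>h. x = Some h \<longleftrightarrow> y = Some h) \<Longrightarrow> x = y"
  by (cases x; cases y) auto

context bounded_spectral_measure
begin

abbreviation restr :: "complex set \<Rightarrow> (complex \<Rightarrow> complex) \<Rightarrow> complex \<Rightarrow> complex" where
  "restr \<sigma> G \<equiv> (\<lambda>z. indicator \<sigma> z * G z)"

lemma borel_restr: "\<sigma> \<in> sets borel \<Longrightarrow> G \<in> borel_measurable borel \<Longrightarrow> restr \<sigma> G \<in> borel_measurable borel"
  by (intro borel_measurable_times borel_measurable_indicator)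

lemma norm_restr_le: "(\<And>z. z \<in> \<sigma> \<Longrightarrow> cmod (G z) \<le> B) \<Longrightarrow> cmod (restr \<sigma> G z) \<le> \<bar>B\<bar>"
  by (auto simp: indicator_def intro: order_trans[OF _ abs_ge_self])

lemma E_T:
  assumes "\<sigma> \<in> sets borel" "G \<in> borel_measurable borel" "\<And>z. cmod (G z) \<le> B"
  shows "E \<sigma> (T G f) = T (restr \<sigma> G) f"
proof -
  have "cmod (indicator \<sigma> z) \<le> 1" for z by (simp add: indicator_def)
  then have "T (restr \<sigma> G) f = T (indicator \<sigma>) (T G f)"
    using assms by (intro T_mult[where B = 1 and C = B]) auto
  then show ?thesis using assms by (simp add: T_indicator)
qed

lemma E_tendsto:
  assumes "range \<sigma> \<subseteq> sets borel" "mono \<sigma>" "(\<Union>n. \<sigma> n) = UNIV"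
  shows "(\<lambda>n. E (\<sigma> n) f) \<longlonglongrightarrow> f"
  using E_tendsto_UN[OF _ _ assms(1,2), of f] assms(3) by (simp add: E_UNIV)

lemma spectral_truncation_eq: "spectral_truncation G n = restr {z. cmod (G z) \<le> real n} G"
  by (auto simp: spectral_truncation_def indicator_def)

lemma sublevel_borel:
  "G \<in> borel_measurable borel \<Longrightarrow> {z::complex. cmod (G z) \<le> r} \<in> sets borel"
  by measurable

text \<open>Apply \<open>E \<sigma>\<close> to the limit defining \<open>g\<close>: as soon as
  \<open>n\<close> exceeds the bound of \<open>G\<close> on \<open>\<sigma>\<close>, truncation no
  longer changes \<open>G\<close> there and the sequence is constant.\<close>

lemma T_restr_eq:
  assumes G: "G \<in> borel_measurable borel" and fg: "spectral_integral E G f = Some g"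
    and \<sigma>: "\<sigma> \<in> sets borel" "\<And>z. z \<in> \<sigma> \<Longrightarrow> cmod (G z) \<le> B"
  shows "T (restr \<sigma> G) f = E \<sigma> g"
proof (rule LIMSEQ_unique)
  have "(\<lambda>n. T (spectral_truncation G n) f) \<longlonglongrightarrow> g"
    using fg by (auto simp: spectral_integral_def convergent_LIMSEQ_iff split: if_splits)
  then show "(\<lambda>n. E \<sigma> (T (spectral_truncation G n) f)) \<longlonglongrightarrow> E \<sigma> g"
    by (rule bounded_linear.tendsto[OF bounded_linear_E[OF \<sigma>(1)]])
  have "E \<sigma> (T (spectral_truncation G n) f) = T (restr \<sigma> G) f" if n: "real n \<ge> B" for n
  proof -
    have "E \<sigma> (T (spectral_truncation G n) f) = T (restr \<sigma> (spectral_truncation G n)) f"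
      unfolding spectral_truncation_eq
      by (intro E_T[where B = "\<bar>real n\<bar>"] \<sigma> borel_restr sublevel_borel G norm_restr_le) simp
    also have "restr \<sigma> (spectral_truncation G n) = restr \<sigma> G"
      using \<sigma>(2) n by (force simp: spectral_truncation_def indicator_def)
    finally show ?thesis .
  qed
  moreover obtain N :: nat where "B \<le> real N" using real_arch_simple by blast
  ultimately have "\<forall>n\<ge>N. E \<sigma> (T (spectral_truncation G n) f) = T (restr \<sigma> G) f" by force
  then show "(\<lambda>n. E \<sigma> (T (spectral_truncation G n) f)) \<longlonglongrightarrow> T (restr \<sigma> G) f"
    by (intro tendsto_eventually) (auto simp: eventually_sequentially)
qed

text \<open>This frees the integral from the truncations in its definition: any exhaustion by sets
  on which \<open>G\<close> is bounded will do. The restrictions to \<open>\<sigma> n\<close> and to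
  the sublevel sets \<open>\<Delta> m\<close> commute; first \<open>n\<close> tends to infinity with
  \<open>m\<close> fixed, then \<open>m\<close>.\<close>

lemma spectral_integral_eqI:
  assumes G: "G \<in> borel_measurable borel"
    and \<sigma>: "range \<sigma> \<subseteq> sets borel" "mono \<sigma>" "(\<Union>n. \<sigma> n) = UNIV"
    and B: "\<And>n z. z \<in> \<sigma> n \<Longrightarrow> cmod (G z) \<le> B n"
    and lim: "(\<lambda>n. T (restr (\<sigma> n) G) f) \<longlonglongrightarrow> g"
  shows "spectral_integral E G f = Some g"
proof -
  define \<Delta> where "\<Delta> m = {z. cmod (G z) \<le> real m}" for m :: nat
  have \<Delta>: "\<Delta> m \<in> sets borel" for m
    unfolding \<Delta>_def using G by (rule sublevel_borel)
  have \<sigma>b: "\<sigma> n \<in> sets borel" for n using \<sigma>(1) by auto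
  have "T (restr (\<Delta> m) G) f = E (\<Delta> m) g" for m
  proof (rule LIMSEQ_unique)
    show "(\<lambda>n. E (\<sigma> n) (T (restr (\<Delta> m) G) f)) \<longlonglongrightarrow> T (restr (\<Delta> m) G) f"
      by (rule E_tendsto[OF \<sigma>])
    have "E (\<sigma> n) (T (restr (\<Delta> m) G) f) = E (\<Delta> m) (T (restr (\<sigma> n) G) f)" for n
    proof -
      have "E (\<sigma> n) (T (restr (\<Delta> m) G) f) = T (restr (\<sigma> n) (restr (\<Delta> m) G)) f"
        by (intro E_T[where B = "\<bar>real m\<bar>"] \<sigma>b borel_restr \<Delta> G norm_restr_le) (simp add: \<Delta>_def)
      also have "\<dots> = T (restr (\<Delta> m) (restr (\<sigma> n) G)) f"
        by (simp add: mult.left_commute)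
      also have "\<dots> = E (\<Delta> m) (T (restr (\<sigma> n) G) f)"
        by (intro E_T[where B = "\<bar>B n\<bar>", symmetric] \<sigma>b borel_restr \<Delta> G norm_restr_le B)
      finally show ?thesis .
    qed
    then show "(\<lambda>n. E (\<sigma> n) (T (restr (\<Delta> m) G) f)) \<longlonglongrightarrow> E (\<Delta> m) g"
      using bounded_linear.tendsto[OF bounded_linear_E[OF \<Delta>] lim] by simp
  qed
  moreover have "(\<lambda>m. E (\<Delta> m) g) \<longlonglongrightarrow> g"
  proof (rule E_tendsto)
    show "mono \<Delta>" by (intro monoI) (auto simp: \<Delta>_def)
    show "(\<Union>m. \<Delta> m) = UNIV" by (auto simp: \<Delta>_def real_arch_simple)
  qed (use \<Delta> in auto)
  ultimately have "(\<lambda>m. T (spectral_truncation G m) f) \<longlonglongrightarrow> g"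
    by (simp add: spectral_truncation_eq \<Delta>_def)
  then show ?thesis by (simp add: spectral_integral_def limI convergentI)
qed

lemma spectral_integral_bounded:
  assumes "G \<in> borel_measurable borel" "\<And>z. cmod (G z) \<le> B"
  shows "spectral_integral E G f = Some (T G f)"
  by (rule spectral_integral_eqI[where \<sigma> = "\<lambda>_. UNIV" and B = "\<lambda>_. B"]) (use assms in \<open>auto simp: mono_def\<close>)

text \<open>On \<open>\<sigma> m\<close> both factors are bounded, so \<open>T_mult\<close> shows
  that \<open>f\<close> with \<open>G * F\<close> and \<open>g\<close> with \<open>G\<close> have
  the same restricted integrals. Hence they converge together and to the same limit.\<close>

lemma spectral_integral_mult_iff:
  assumes F: "F \<in> borel_measurable borel" and G: "G \<in> borel_measurable borel"
    and fg: "spectral_integral E F f = Some g"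
  shows "spectral_integral E (\<lambda>z. G z * F z) f = Some h \<longleftrightarrow> spectral_integral E G g = Some h"
proof -
  define \<sigma> where "\<sigma> m = {z. cmod (F z) \<le> real m} \<inter> {z. cmod (G z) \<le> real m}" for m :: nat
  have \<sigma>b: "\<sigma> m \<in> sets borel" for m
    unfolding \<sigma>_def by (intro sets.Int sublevel_borel F G)
  have "mono \<sigma>" by (intro monoI) (auto simp: \<sigma>_def)
  have cover: "(\<Union>m. \<sigma> m) = UNIV"
  proof -
    have "z \<in> (\<Union>m. \<sigma> m)" for z
    proof -
      obtain m where "max (cmod (F z)) (cmod (G z)) \<le> real m" using real_arch_simple by blast
      then show ?thesis by (auto simp: \<sigma>_def)
    qed
    then show ?thesis by blast
  qed
  have \<sigma>F: "cmod (F z) \<le> real m" and \<sigma>G: "cmod (G z) \<le> real m" if "z \<in> \<sigma> m" for z m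
    using that by (auto simp: \<sigma>_def)
  have GF: "(\<lambda>z. G z * F z) \<in> borel_measurable borel" using F G by measurable
  have \<sigma>GF: "cmod (G z * F z) \<le> real m * real m" if "z \<in> \<sigma> m" for z m
    unfolding norm_mult by (intro mult_mono \<sigma>F[OF that] \<sigma>G[OF that]) auto
  have eq: "T (restr (\<sigma> m) (\<lambda>z. G z * F z)) f = T (restr (\<sigma> m) G) g" for m
  proof -
    have "restr (\<sigma> m) (\<lambda>z. G z * F z) = (\<lambda>z. restr (\<sigma> m) G z * restr (\<sigma> m) F z)"
      by (auto simp: indicator_def)
    then have "T (restr (\<sigma> m) (\<lambda>z. G z * F z)) f = T (restr (\<sigma> m) G) (T (restr (\<sigma> m) F) f)"
      by (simp only:) (intro T_mult[where B = "\<bar>real m\<bar>" and C = "\<bar>real m\<bar>"]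
          borel_restr \<sigma>b F G norm_restr_le \<sigma>F \<sigma>G)
    also have "T (restr (\<sigma> m) F) f = E (\<sigma> m) g"
      by (intro T_restr_eq[OF F fg \<sigma>b \<sigma>F])
    \<comment> \<open>The projection is written as an integral so that \<open>T_mult\<close> can
      absorb it into the restriction of \<open>G\<close>.\<close>
    also have "\<dots> = T (indicator (\<sigma> m)) g" by (simp add: T_indicator \<sigma>b)
    also have "T (restr (\<sigma> m) G) \<dots> = T (\<lambda>z. restr (\<sigma> m) G z * indicator (\<sigma> m) z) g"
      by (intro T_mult[where B = "\<bar>real m\<bar>" and C = 1, symmetric] borel_restr \<sigma>b G norm_restr_le \<sigma>G)
        (use \<sigma>b in \<open>auto simp: indicator_def\<close>)
    also have "(\<lambda>z. restr (\<sigma> m) G z * indicator (\<sigma> m) z) = restr (\<sigma> m) G"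
      by (auto simp: indicator_def)
    finally show ?thesis .
  qed
  have lim: "(\<lambda>m. E (\<sigma> m) h) \<longlonglongrightarrow> h"
    using \<sigma>b by (intro E_tendsto \<open>mono \<sigma>\<close> cover) auto
  show ?thesis
  proof
    assume "spectral_integral E (\<lambda>z. G z * F z) f = Some h"
    from T_restr_eq[OF GF this \<sigma>b \<sigma>GF] eq have "T (restr (\<sigma> m) G) g = E (\<sigma> m) h" for m
      by metis
    then show "spectral_integral E G g = Some h"
      using \<sigma>b lim by (intro spectral_integral_eqI[OF G _ \<open>mono \<sigma>\<close> cover \<sigma>G]) auto
  next
    assume "spectral_integral E G g = Some h"
    from T_restr_eq[OF G this \<sigma>b \<sigma>G] eq have "T (restr (\<sigma> m) (\<lambda>z. G z * F z)) f = E (\<sigma> m) h" for m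
      by metis
    then show "spectral_integral E (\<lambda>z. G z * F z) f = Some h"
      using \<sigma>b lim by (intro spectral_integral_eqI[OF GF _ \<open>mono \<sigma>\<close> cover \<sigma>GF]) auto
  qed
qed

section \<open>Powers of the operator\<close>

abbreviation A where "A \<equiv> spectral_integral E (\<lambda>z. z)"

lemma spectral_integral_power_0: "spectral_integral E (\<lambda>z. z ^ 0) f = Some f"
proof -
  have "(\<lambda>z::complex. z ^ 0) = indicator UNIV" by (auto simp: indicator_def)
  moreover have "spectral_integral E (indicator UNIV) f = Some (T (indicator UNIV) f)"
    by (rule spectral_integral_bounded[where B = 1]) auto
  moreover have "T (indicator UNIV) f = f" by (rule trans[OF T_indicator E_UNIV]) simp
  ultimately show ?thesis by (simp only:)
qed

lemma spectral_integral_power_Suc: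
  assumes "spectral_integral E (\<lambda>z. z ^ n) f = Some g"
  shows "spectral_integral E (\<lambda>z. z ^ Suc n) f = A g"
proof -
  have "spectral_integral E (\<lambda>z. z ^ Suc n) f = Some h \<longleftrightarrow> A g = Some h" for h
    unfolding power_Suc by (rule spectral_integral_mult_iff[OF _ _ assms]) measurable
  then show ?thesis by (rule option_eqI)
qed

lemma spectral_integral_power_of_operator_power:
  "operator_power A n f = Some g \<Longrightarrow> spectral_integral E (\<lambda>z. z ^ n) f = Some g"
proof (induction n arbitrary: g)
  case 0
  then show ?case using spectral_integral_power_0[of f] by (simp only: operator_power.simps)
next
  case (Suc n)
  then obtain h where h: "operator_power A n f = Some h" "A h = Some g"
    by (auto simp: map_comp_Some_iff)
  show ?case using spectral_integral_power_Suc[OF Suc.IH[OF h(1)]] h(2) by (simp only:)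
qed

text \<open>Integrals of all powers are assumed to exist, because \<open>A\<close> is applied to the
  preceding integral at every step.\<close>

lemma operator_power_of_spectral_integral_power:
  assumes "\<And>n. spectral_integral E (\<lambda>z. z ^ n) f = Some (g n)"
  shows "operator_power A n f = Some (g n)"
proof (induction n)
  case 0
  show ?case using assms[of 0] spectral_integral_power_0[of f] by (simp only: operator_power.simps)
next
  case (Suc n)
  have "A (g n) = Some (g (Suc n))"
    using spectral_integral_power_Suc[OF assms, of n] assms[of "Suc n"] by (simp only:)
  then show ?case using Suc by (simp add: map_comp_Some_iff)
qed

end

section \<open>Gevrey classes\<close>

lemma power_le_fact_exp:
  fixes x :: real
  assumes "x \<ge> 0"
  shows "x ^ n \<le> fact n * exp x"
proof -
  have "x ^ n /\<^sub>R fact n \<le> (\<Sum>k. x ^ k /\<^sub>R fact k)"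
    using sum_le_suminf[OF summable_exp_generic, of "{n}" x] assms by simp
  then show ?thesis by (simp add: exp_def field_simps)
qed

lemma power_powr: "x \<ge> 0 \<Longrightarrow> (x ^ n) powr b = (x powr b) ^ n" for x b :: real
  by (induction n) (simp_all add: powr_mult)

text \<open>Raise \<open>x ^ n \<le> fact n * exp x\<close> to the power \<open>\<beta>\<close> at
  \<open>x = s * r powr (1 / \<beta>)\<close>. With \<open>s = t / \<beta>\<close> the exponent
  becomes \<open>t * r powr (1 / \<beta>)\<close>.\<close>

lemma power_le_gevrey_exp:
  fixes r s \<beta> :: real
  assumes r: "r \<ge> 0" and s: "s > 0" and \<beta>: "\<beta> > 0"
  shows "r ^ n \<le> (s powr - \<beta>) ^ n * fact n powr \<beta> * exp (\<beta> * s * r powr (1 / \<beta>))"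
proof -
  define x where "x = s * r powr (1 / \<beta>)"
  have x: "x \<ge> 0" using s by (simp add: x_def)
  have "x powr \<beta> = s powr \<beta> * r"
    using r s \<beta> by (simp add: x_def powr_mult powr_powr)
  then have "r ^ n = (s powr - \<beta> * x powr \<beta>) ^ n"
    using s by (simp add: powr_minus field_simps)
  also have "\<dots> = (s powr - \<beta>) ^ n * (x ^ n) powr \<beta>"
    using x by (simp add: power_mult_distrib power_powr)
  also have "(x ^ n) powr \<beta> \<le> (fact n * exp x) powr \<beta>"
    using power_le_fact_exp[OF x] x \<beta> by (intro powr_mono2) auto
  also have "(fact n * exp x) powr \<beta> = fact n powr \<beta> * exp (\<beta> * x)"
    by (simp add: powr_mult powr_def[of "exp x"] mult.commute)
  finally show ?thesis using s by (simp add: x_def mult_left_mono mult_ac)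
qed

text \<open>After \<open>fact n \<le> n ^ n\<close> the weight is at most the \<open>n\<close>-th
  power of \<alpha> (n / k)^\<beta>. Over real n this is smallest at n = k \<theta>, where the base
  equals exp (- \<beta>). Rounding down loses less than one unit of n, which costs the factor
  \<open>exp \<beta>\<close>.\<close>

lemma gevrey_weight_at_optimal_index:
  fixes \<alpha> \<beta> \<theta> :: real
  assumes k: "k > 0" and \<theta>: "\<theta> > 0" and \<beta>: "\<beta> > 0" and \<alpha>: "\<alpha> > 0" "\<alpha> * \<theta> powr \<beta> = exp (- \<beta>)"
    and n: "n = nat \<lfloor>real k * \<theta>\<rfloor>"
  shows "\<alpha> ^ n * fact n powr \<beta> / (real k powr \<beta>) ^ n \<le> exp \<beta> * exp (- \<beta> * \<theta>) ^ k"
proof -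
  have n_le: "real n \<le> real k * \<theta>" and n_ge: "real k * \<theta> - 1 \<le> real n"
    using n k \<theta> by (auto simp: of_nat_nat)
  have "fact n powr \<beta> \<le> (real n ^ n) powr \<beta>"
    using fact_le_power[of n, where 'a = real] \<beta> by (intro powr_mono2) auto
  also have "\<dots> \<le> ((real k * \<theta>) ^ n) powr \<beta>"
    using n_le \<beta> by (intro powr_mono2 power_mono) auto
  also have "\<dots> = (real k powr \<beta>) ^ n * (\<theta> powr \<beta>) ^ n"
    using k \<theta> by (simp add: powr_mult power_mult_distrib power_powr)
  finally have "\<alpha> ^ n * fact n powr \<beta> \<le> \<alpha> ^ n * ((real k powr \<beta>) ^ n * (\<theta> powr \<beta>) ^ n)"
    using \<alpha>(1) by (intro mult_left_mono) auto
  also have "\<dots> = (real k powr \<beta>) ^ n * exp (- \<beta>) ^ n"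
    unfolding \<alpha>(2)[symmetric] by (simp add: power_mult_distrib)
  finally have "\<alpha> ^ n * fact n powr \<beta> / (real k powr \<beta>) ^ n \<le> exp (- \<beta>) ^ n"
    using k by (simp add: field_simps)
  also have "\<dots> = exp (- \<beta> * real n)" by (simp add: exp_of_nat_mult[symmetric] mult.commute)
  also have "\<dots> \<le> exp (\<beta> + real k * (- \<beta> * \<theta>))"
    using mult_left_mono[OF n_ge, of \<beta>] \<beta> by (simp add: algebra_simps)
  also have "\<dots> = exp \<beta> * exp (- \<beta> * \<theta>) ^ k"
    by (simp only: exp_add exp_of_nat_mult)
  finally show ?thesis .
qed

section \<open>Domains of exponentials and Gevrey bounds\<close>

context bounded_spectral_measure
begin

abbreviation gevrey_exp :: "real \<Rightarrow> real \<Rightarrow> complex \<Rightarrow> complex" where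
  "gevrey_exp \<beta> t \<equiv> (\<lambda>z. complex_of_real (exp (t * cmod z powr (1 / \<beta>))))"

text \<open>The quotient \<open>H n\<close> of \<open>z ^ n\<close> by the exponential is bounded by
  \<open>C n\<close>, so the integral of \<open>z ^ n\<close> at \<open>f\<close> is a bounded
  operator applied to the single vector \<open>g\<close>.\<close>

lemma dom_gevrey_exp_imp_gevrey:
  assumes \<beta>: "\<beta> > 0" and t: "t > 0" and f: "f \<in> dom (spectral_integral E (gevrey_exp \<beta> t))"
  shows "f \<in> C_infinity A \<and> (\<exists>c>0. \<forall>n.
    norm (the (operator_power A n f)) \<le> c * ((t / \<beta>) powr - \<beta>) ^ n * fact n powr \<beta>)"
proof -
  let ?G = "gevrey_exp \<beta> t"
  obtain g where g: "spectral_integral E ?G f = Some g" using f by auto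
  have G: "?G \<in> borel_measurable borel" by measurable
  define H where "H n z = z ^ n / ?G z" for n z
  define C where "C n = ((t / \<beta>) powr - \<beta>) ^ n * fact n powr \<beta>" for n
  have H: "H n \<in> borel_measurable borel" for n
    unfolding H_def using G by measurable
  have HC: "cmod (H n z) \<le> C n" for n z
    using power_le_gevrey_exp[of "cmod z" "t / \<beta>" \<beta> n] \<beta> t
    by (simp add: H_def C_def norm_divide norm_power field_simps)
  have "spectral_integral E (\<lambda>z. z ^ n) f = Some (T (H n) g)" for n
  proof -
    have "spectral_integral E (\<lambda>z. H n z * ?G z) f = Some (T (H n) g)"
      using spectral_integral_mult_iff[OF G H g] spectral_integral_bounded[OF H HC] by simp
    then show ?thesis by (simp add: H_def)
  qed
  then have power: "operator_power A n f = Some (T (H n) g)" for n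
    by (rule operator_power_of_spectral_integral_power)
  \<comment> \<open>The summand 1 keeps the constant positive when
    \<open>K * norm g = 0\<close>.\<close>
  have "norm (T (H n) g) \<le> (4 * K * norm g + 1) * C n" for n
  proof -
    have "norm (T (H n) g) \<le> 4 * K * C n * norm g" by (rule norm_T_le[OF H HC])
    also have "\<dots> \<le> (4 * K * norm g + 1) * C n"
      using order_trans[OF norm_ge_zero HC, of n] by (simp add: algebra_simps)
    finally show ?thesis .
  qed
  then show ?thesis
    using power K_nonneg
    by (auto simp: C_infinity_def C_def mult.assoc intro!: exI[of _ "4 * K * norm g + 1"] add_nonneg_pos)
qed

lemma gevrey_imp_dom_gevrey_exp:
  assumes \<beta>: "\<beta> > 0" and f: "f \<in> C_infinity A" and c: "c > 0" and \<alpha>: "\<alpha> > 0"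
    and bound: "\<And>n. norm (the (operator_power A n f)) \<le> c * \<alpha> ^ n * fact n powr \<beta>"
    and t: "t > 0" "t < \<beta> * (\<alpha> powr (- 1 / \<beta>) / exp 1)"
  shows "f \<in> dom (spectral_integral E (gevrey_exp \<beta> t))"
proof -
  let ?G = "gevrey_exp \<beta> t"
  define \<theta> where "\<theta> = \<alpha> powr (- 1 / \<beta>) / exp 1"
  have \<theta>: "\<theta> > 0" using \<alpha> by (simp add: \<theta>_def)
  have "\<alpha> * \<theta> powr \<beta> = exp (- \<beta>)"
    using \<alpha> \<beta> by (simp add: \<theta>_def powr_divide powr_mult powr_powr powr_minus exp_powr_real exp_minus field_simps)
  note weight = gevrey_weight_at_optimal_index[OF _ \<theta> \<beta> \<alpha> this]
  define g where "g n = the (operator_power A n f)" for n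
  have "operator_power A n f = Some (g n)" for n
    using f by (simp add: C_infinity_def g_def domIff)
  then have g: "spectral_integral E (\<lambda>z. z ^ n) f = Some (g n)" for n
    by (rule spectral_integral_power_of_operator_power)
  have G: "?G \<in> borel_measurable borel" by measurable
  have pow: "(\<lambda>z::complex. z ^ n) \<in> borel_measurable borel" for n by measurable
  define shell where
    "shell k = {z. real k \<le> cmod z powr (1 / \<beta>) \<and> cmod z powr (1 / \<beta>) < real (Suc k)}" for k
  define \<sigma> where "\<sigma> m = {z. cmod z powr (1 / \<beta>) < real m}" for m
  have shell: "shell k \<in> sets borel" for k unfolding shell_def by measurable
  have \<sigma>: "\<sigma> m \<in> sets borel" for m unfolding \<sigma>_def by measurable
  have G_le: "cmod (?G z) \<le> exp (t * real m)" if "cmod z powr (1 / \<beta>) < real m" for z m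
    using that t by simp
  define a where "a k = T (restr (shell k) ?G) f" for k
  \<comment> \<open>The factor \<open>4 * K\<close> comes from \<open>norm_T_le\<close>,
    \<open>exp t\<close> from the upper end \<open>k + 1\<close> of the shell, the second
    \<open>K\<close> from the projection onto the shell, and \<open>c * exp \<beta>\<close> from the
    Gevrey bound and the rounding of \<open>n\<close>.\<close>
  define D where "D = 4 * K * exp t * (K * (c * exp \<beta>))"
  \<comment> \<open>The shell around the origin is left out, since division by \<open>z ^ n\<close>
    can fail there; one term does not affect summability.\<close>
  have a_le: "norm (a k) \<le> D * (exp (t - \<beta> * \<theta>)) ^ k" if k: "k > 0" for k
  proof -
    define n where "n = nat \<lfloor>real k * \<theta>\<rfloor>"
    define H where "H z = indicator (shell k) z * ?G z / z ^ n" for z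
    have H: "H \<in> borel_measurable borel"
      unfolding H_def using borel_restr[OF shell G] pow by measurable
    have HC: "cmod (H z) \<le> exp (t * real (Suc k)) / (real k powr \<beta>) ^ n" for z
    proof (cases "z \<in> shell k")
      case True
      then have "real k powr \<beta> \<le> (cmod z powr (1 / \<beta>)) powr \<beta>"
        using \<beta> by (intro powr_mono2) (auto simp: shell_def)
      also have "\<dots> = cmod z" using \<beta> by (simp add: powr_powr)
      finally have "(real k powr \<beta>) ^ n \<le> cmod z ^ n" by (intro power_mono) auto
      moreover have "(real k powr \<beta>) ^ n > 0" using k by simp
      ultimately show ?thesis
        using G_le[of z "Suc k"] True unfolding H_def
        by (simp add: norm_divide norm_power shell_def frac_le)
    qed (simp add: H_def)
    have nz: "z \<noteq> 0" if "z \<in> shell k" for z using that k by (auto simp: shell_def)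
    have shell_bdd: "cmod (z ^ n) \<le> (real (Suc k) powr \<beta>) ^ n" if "z \<in> shell k" for z
    proof -
      have "cmod z = (cmod z powr (1 / \<beta>)) powr \<beta>" using \<beta> by (simp add: powr_powr)
      also have "\<dots> \<le> real (Suc k) powr \<beta>"
        using that \<beta> by (intro powr_mono2) (auto simp: shell_def)
      finally show ?thesis by (simp add: norm_power power_mono)
    qed
    \<comment> \<open>The factor \<open>z ^ n\<close> is restricted to the shell as well, so that
      both factors are bounded and \<open>T_mult\<close> applies; its integral at \<open>f\<close>
      is the projection of \<open>g n\<close>.\<close>
    have "restr (shell k) ?G = (\<lambda>z. H z * restr (shell k) (\<lambda>z. z ^ n) z)"
      using nz by (auto simp: H_def indicator_def fun_eq_iff)
    then have "a k = T H (T (restr (shell k) (\<lambda>z. z ^ n)) f)"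
      unfolding a_def by (simp only:) (intro T_mult[where B = "exp (t * real (Suc k)) / (real k powr \<beta>) ^ n"
          and C = "\<bar>(real (Suc k) powr \<beta>) ^ n\<bar>"] H HC borel_restr shell pow norm_restr_le shell_bdd)
    also have "T (restr (shell k) (\<lambda>z. z ^ n)) f = E (shell k) (g n)"
      by (rule T_restr_eq[OF pow g shell shell_bdd])
    finally have "norm (a k) \<le> 4 * K * (exp (t * real (Suc k)) / (real k powr \<beta>) ^ n) * norm (E (shell k) (g n))"
      using norm_T_le[OF H HC] by simp
    also have "\<dots> \<le> 4 * K * (exp (t * real (Suc k)) / (real k powr \<beta>) ^ n) * (K * (c * \<alpha> ^ n * fact n powr \<beta>))"
      using K_nonneg norm_E_le[OF shell, of k "g n"] mult_left_mono[OF bound[of n] K_nonneg]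
      by (intro mult_left_mono) (auto simp: g_def)
    also have "\<dots> = 4 * K * exp (t * real (Suc k)) * (K * (c * (\<alpha> ^ n * fact n powr \<beta> / (real k powr \<beta>) ^ n)))"
      by simp
    also have "\<dots> \<le> 4 * K * exp (t * real (Suc k)) * (K * (c * (exp \<beta> * exp (- \<beta> * \<theta>) ^ k)))"
      using weight[OF k n_def] c K_nonneg by (intro mult_left_mono) auto
    also have "exp (t * real (Suc k)) = exp t * exp t ^ k"
      by (simp add: exp_of_nat_mult[symmetric] exp_add[symmetric] algebra_simps)
    also have "4 * K * (exp t * exp t ^ k) * (K * (c * (exp \<beta> * exp (- \<beta> * \<theta>) ^ k)))
        = D * (exp t * exp (- \<beta> * \<theta>)) ^ k"
      by (simp add: D_def power_mult_distrib)
    also have "exp t * exp (- \<beta> * \<theta>) = exp (t - \<beta> * \<theta>)"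
      by (simp add: exp_add[symmetric])
    finally show ?thesis .
  qed
  have "summable (\<lambda>k. D * (exp (t - \<beta> * \<theta>)) ^ k)"
    \<comment> \<open>The upper bound on \<open>t\<close> says precisely that the ratio
      \<open>exp (t - \<beta> * \<theta>)\<close> is below 1.\<close>
    using t by (intro summable_mult summable_geometric) (simp add: \<theta>_def)
  then have "summable a"
    by (rule summable_comparison_test'[where N = 1]) (use a_le in auto)
  then have "(\<lambda>m. \<Sum>k<m. a k) \<longlonglongrightarrow> suminf a" by (rule summable_LIMSEQ)
  moreover have "(\<Sum>k<m. a k) = T (restr (\<sigma> m) ?G) f" for m
  proof -
    have res: "restr (\<sigma> m) ?G \<in> borel_measurable borel" "cmod (restr (\<sigma> m) ?G z) \<le> \<bar>exp (t * real m)\<bar>" for z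
      by (intro borel_restr \<sigma> G) (intro norm_restr_le, simp add: \<sigma>_def t)
    \<comment> \<open>Every shell contribution is a projection of one vector, the integral over the
      whole disc, so finite additivity of \<open>E\<close> adds them up.\<close>
    have "a k = E (shell k) (T (restr (\<sigma> m) ?G) f)" if "k < m" for k
    proof -
      have "restr (shell k) (restr (\<sigma> m) ?G) = restr (shell k) ?G"
        using that by (auto simp: indicator_def shell_def \<sigma>_def)
      then show ?thesis unfolding a_def E_T[OF shell res] by simp
    qed
    then have "(\<Sum>k<m. a k) = (\<Sum>k<m. E (shell k) (T (restr (\<sigma> m) ?G) f))" by simp
    also have "\<dots> = E (\<Union>k<m. shell k) (T (restr (\<sigma> m) ?G) f)"
    proof (rule E_finite_UN[symmetric])
      have "k = l" if "z \<in> shell k" "z \<in> shell l" for z k l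
        using that unfolding shell_def by auto
      then show "disjoint_family_on shell {..<m}" unfolding disjoint_family_on_def by blast
    qed (use shell in auto)
    also have "(\<Union>k<m. shell k) = \<sigma> m"
    proof
      show "\<sigma> m \<subseteq> (\<Union>k<m. shell k)"
      proof
        fix z assume z: "z \<in> \<sigma> m"
        define k where "k = nat \<lfloor>cmod z powr (1 / \<beta>)\<rfloor>"
        have "real k \<le> cmod z powr (1 / \<beta>)" "cmod z powr (1 / \<beta>) < real (Suc k)"
          by (simp_all add: k_def) linarith
        then have "z \<in> shell k" "k < m" using z by (auto simp: shell_def \<sigma>_def)
        then show "z \<in> (\<Union>k<m. shell k)" by blast
      qed
    qed (auto simp: shell_def \<sigma>_def)
    also have "E (\<sigma> m) (T (restr (\<sigma> m) ?G) f) = T (restr (\<sigma> m) (restr (\<sigma> m) ?G)) f"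
      by (rule E_T[OF \<sigma> res])
    also have "restr (\<sigma> m) (restr (\<sigma> m) ?G) = restr (\<sigma> m) ?G"
      by (auto simp: indicator_def)
    finally show ?thesis .
  qed
  ultimately have "(\<lambda>m. T (restr (\<sigma> m) ?G) f) \<longlonglongrightarrow> suminf a" by simp
  moreover have "mono \<sigma>" by (intro monoI) (auto simp: \<sigma>_def)
  moreover have "(\<Union>m. \<sigma> m) = UNIV" by (auto simp: \<sigma>_def intro: reals_Archimedean2)
  ultimately have "spectral_integral E ?G f = Some (suminf a)"
    using \<sigma> by (intro spectral_integral_eqI[OF G, of \<sigma> "\<lambda>m. exp (t * real m)"])
      (auto simp: \<sigma>_def t)
  then show ?thesis by blast
qed

end

lemma resolution_of_identity_spectral_measure_of:
  assumes "scalar_type_spectral A"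
  shows "resolution_of_identity A (spectral_measure_of A)"
  using assms unfolding scalar_type_spectral_def spectral_measure_of_def by (simp add: some_eq_ex)

theorem corollary4p1:
  fixes A :: "'a::complex_banach operator" and \<beta> :: real
  assumes "\<beta> > 0" and "scalar_type_spectral A"
  shows "gevrey_roumieu \<beta> A =
           (\<Union>t\<in>{t::real. t > 0}.
              dom (operator_function (\<lambda>z. complex_of_real (exp (t * cmod z powr (1 / \<beta>)))) A))
       \<and> gevrey_beurling \<beta> A =
           (\<Inter>t\<in>{t::real. t > 0}.
              dom (operator_function (\<lambda>z. complex_of_real (exp (t * cmod z powr (1 / \<beta>)))) A))"
proof -
  \<comment> \<open>Both \<open>A\<close> and its exponentials are integrals against this one chosen
    measure.\<close>
  define E where "E = spectral_measure_of A"
  have "resolution_of_identity A E"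
    unfolding E_def using assms(2) by (rule resolution_of_identity_spectral_measure_of)
  then have E: "spectral_measure E" and A: "A = spectral_integral E (\<lambda>z. z)"
    by (auto simp: resolution_of_identity_def)
  obtain K where "K \<ge> 0" "\<forall>\<delta>\<in>sets borel. \<forall>f. norm (E \<delta> f) \<le> K * norm f"
    using spectral_measure_bounded[OF E] by blast
  then interpret bounded_spectral_measure E K
    using E by unfold_locales auto
  define dom_exp where "dom_exp t = dom (operator_function (gevrey_exp \<beta> t) A)" for t
  define bound where "bound \<alpha> f \<longleftrightarrow> (\<exists>c>0. \<forall>n.
     norm (the (operator_power A n f)) \<le> c * \<alpha> ^ n * fact n powr \<beta>)" for \<alpha> f
  have to_gevrey: "f \<in> C_infinity A" "bound ((t / \<beta>) powr - \<beta>) f" if "t > 0" "f \<in> dom_exp t" for t f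
    using dom_gevrey_exp_imp_gevrey[OF assms(1) that(1), of f] that(2)
    by (auto simp: dom_exp_def bound_def operator_function_def E_def[symmetric] A[symmetric])
  have to_dom: "f \<in> dom_exp t"
    if "f \<in> C_infinity A" "\<alpha> > 0" "bound \<alpha> f" "t > 0" "t < \<beta> * (\<alpha> powr (- 1 / \<beta>) / exp 1)" for f t \<alpha>
    using gevrey_imp_dom_gevrey_exp[OF assms(1), of f _ \<alpha> t] that
    by (auto simp: dom_exp_def bound_def operator_function_def E_def[symmetric] A[symmetric])
  have "gevrey_roumieu \<beta> A = (\<Union>t\<in>{t. t > 0}. dom_exp t)"
  proof (intro equalityI subsetI)
    fix f assume "f \<in> gevrey_roumieu \<beta> A"
    then obtain \<alpha> where f: "f \<in> C_infinity A" "\<alpha> > 0" "bound \<alpha> f"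
      by (auto simp: gevrey_roumieu_def bound_def)
    \<comment> \<open>Half of the threshold in \<open>to_dom\<close>.\<close>
    define t where "t = \<beta> * (\<alpha> powr (- 1 / \<beta>) / exp 1) / 2"
    have "t > 0" using assms(1) f(2) by (simp add: t_def)
    moreover have "t < \<beta> * (\<alpha> powr (- 1 / \<beta>) / exp 1)" using \<open>t > 0\<close> unfolding t_def by linarith
    ultimately show "f \<in> (\<Union>t\<in>{t. t > 0}. dom_exp t)" using to_dom[OF f] by blast
  next
    fix f assume "f \<in> (\<Union>t\<in>{t. t > 0}. dom_exp t)"
    then obtain t where t: "t > 0" "f \<in> dom_exp t" by blast
    moreover have "(t / \<beta>) powr - \<beta> > 0" using t(1) assms(1) by simp
    ultimately show "f \<in> gevrey_roumieu \<beta> A"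
      using to_gevrey[OF t] unfolding gevrey_roumieu_def bound_def by blast
  qed
  moreover have "gevrey_beurling \<beta> A = (\<Inter>t\<in>{t. t > 0}. dom_exp t)"
  proof (intro equalityI subsetI INT_I)
    fix f and t :: real assume f: "f \<in> gevrey_beurling \<beta> A" and "t \<in> {t. t > 0}"
    then have t: "t > 0" by simp
    \<comment> \<open>Chosen so that the threshold in \<open>to_dom\<close> equals
      \<open>2 * t\<close>.\<close>
    define \<alpha> where "\<alpha> = (2 * exp 1 * t / \<beta>) powr - \<beta>"
    have "\<alpha> > 0" using t assms(1) by (simp add: \<alpha>_def)
    moreover have "\<alpha> powr (- 1 / \<beta>) = 2 * exp 1 * t / \<beta>"
      using t assms(1) by (simp add: \<alpha>_def powr_powr)
    then have "t < \<beta> * (\<alpha> powr (- 1 / \<beta>) / exp 1)" using t assms(1) by simp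
    moreover have "f \<in> C_infinity A" "bound \<alpha> f"
      using f \<open>\<alpha> > 0\<close> by (auto simp: gevrey_beurling_def bound_def)
    ultimately show "f \<in> dom_exp t" using t to_dom by blast
  next
    fix f assume f: "f \<in> (\<Inter>t\<in>{t. t > 0}. dom_exp t)"
    have "f \<in> C_infinity A" using to_gevrey(1)[of 1 f] f by simp
    moreover have "bound \<alpha> f" if \<alpha>: "\<alpha> > 0" for \<alpha>
    proof -
      \<comment> \<open>The solution of \<open>(t / \<beta>) powr - \<beta> = \<alpha>\<close>, so
        that \<open>to_gevrey\<close> yields exactly the prescribed \<alpha>.\<close>
      define t where "t = \<beta> * \<alpha> powr (- 1 / \<beta>)"
      have "t > 0" using \<alpha> assms(1) by (simp add: t_def)
      moreover have "(t / \<beta>) powr - \<beta> = \<alpha>" using \<alpha> assms(1) by (simp add: t_def powr_powr)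
      ultimately show ?thesis using to_gevrey(2)[of t f] f by simp
    qed
    ultimately show "f \<in> gevrey_beurling \<beta> A" by (auto simp: gevrey_beurling_def bound_def)
  qed
  ultimately show ?thesis unfolding dom_exp_def ..
qed

end
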